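(* Let $A$ be as in the context. If $A$ is $\Delta$-normal for some regular triangulation $\Delta$ of $cone(A)$, then there exists a generic cost vector $c\in\mathbb Z^n$ such that $\Delta=\Delta_c$ and $IP_{A,c}$ is a Gomory family.
   Context: $A\in\mathbb Z^{d\times n}$ has rank $d$, columns $a_1,\dots,a_n$, $cone(A)$ pointed, $\{x\in\mathbb R^n_{\ge0}:Ax=0\}=\{0\}$, $\mathbb ZA=\mathbb Z^d$, $\mathbb NA=\{Au:u\in\mathbb N^n\}$. For $c\in\mathbb R^n$, $\Delta_c$ is the collection of $\sigma\subseteq\{1,\dots,n\}$ (identified with cones $cone(A_\sigma)$) for which some $y\in\mathbb R^d$ has $y\cdot a_j=c_j$ ($j\in\sigma$), $y\cdot a_j<c_j$ ($j\notin\sigma$). A triangulation $\Delta$ of $cone(A)$ (with cones spanned by columns of $A$) is regular if $\Delta=\Delta_{c'}$ for some $c'$. A cost vector $c$ is generic if $\Delta_c$ is a triangulation and every program $IP_{A,c}(b)=\min\{c\cdot x: Ax=b,\ x\in\mathbb N^n\}$, $b\in\mathbb NA$, has a unique optimal solution; $IP_{A,c}$ is the family of these programs. For a maximal face $\sigma$ of $\Delta_c$ let $\tilde c_{\bar\sigma}=c_{\bar\sigma}-c_\sigma A_\sigma^{-1}A_{\bar\sigma}$; the group relaxation $G^\sigma(b)$ is $\min\{\tilde c_{\bar\sigma}\cdot x_{\bar\sigma}: A_\sigma x_\sigma+A_{\bar\sigma}x_{\bar\sigma}=b,\ x_{\bar\sigma}\ge0,\ x\in\mathbb Z^n\}$,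 which solves $IP_{A,c}(b)$ if its optimal solution is non-negative. $IP_{A,c}$ is a Gomory family if for every $b\in\mathbb NA$ some maximal face $\sigma$ of $\Delta_c$ has $G^\sigma(b)$ solving $IP_{A,c}(b)$. $A$ is $\Delta$-normal for a triangulation $\Delta$ if for every maximal face $\sigma$ of $\Delta$, the columns of $A$ lying in $cone(A_\sigma)$ form a Hilbert basis of $cone(A_\sigma)$ (i.e. generate the semigroup $cone(A_\sigma)\cap\mathbb Z^d$). *)

theory Defs
  imports Complex_Main
begin

text \<open>Conventions. The matrix A in Z^{d x n} is A :: nat => nat => int, entry A i j
  for i < d, j < n; column j is a_j. Vectors in R^d / Z^d are functions nat => real / int,
  only coordinates i < d matter (cone points are normalised to be 0 at i >= d).
  Vectors in R^n, N^n, Z^n are functions on nat that vanish at j >= n whenever uniqueness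
  matters. Subsets sigma of {1..n} are subsets of {..<n}.\<close>

definition colv :: "nat \<Rightarrow> (nat \<Rightarrow> nat \<Rightarrow> int) \<Rightarrow> nat \<Rightarrow> nat \<Rightarrow> real" where
  "colv d A j = (\<lambda>i. if i < d then real_of_int (A i j) else 0)"

definition dotc :: "nat \<Rightarrow> (nat \<Rightarrow> nat \<Rightarrow> int) \<Rightarrow> (nat \<Rightarrow> real) \<Rightarrow> nat \<Rightarrow> real" where
  "dotc d A y j = (\<Sum>i<d. y i * real_of_int (A i j))"

definition cone_of :: "nat \<Rightarrow> (nat \<Rightarrow> nat \<Rightarrow> int) \<Rightarrow> nat set \<Rightarrow> (nat \<Rightarrow> real) set" where
  "cone_of d A S = {b. (\<forall>i\<ge>d. b i = 0) \<and>
      (\<exists>x::nat \<Rightarrow> real. (\<forall>j\<in>S. x j \<ge> 0) \<and>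
         (\<forall>i<d. b i = (\<Sum>j\<in>S. real_of_int (A i j) * x j)))}"

definition int_points :: "nat \<Rightarrow> (nat \<Rightarrow> real) set" where
  "int_points d = {b. (\<forall>i. b i \<in> \<int>) \<and> (\<forall>i\<ge>d. b i = 0)}"

definition full_row_rank :: "nat \<Rightarrow> nat \<Rightarrow> (nat \<Rightarrow> nat \<Rightarrow> int) \<Rightarrow> bool" where
  "full_row_rank d n A \<longleftrightarrow>
     (\<forall>y::nat \<Rightarrow> real. (\<forall>j<n. dotc d A y j = 0) \<longrightarrow> (\<forall>i<d. y i = 0))"

definition pointed_cone :: "nat \<Rightarrow> nat \<Rightarrow> (nat \<Rightarrow> nat \<Rightarrow> int) \<Rightarrow> bool" where
  "pointed_cone d n A \<longleftrightarrow>
     (\<forall>b. b \<in> cone_of d A {..<n} \<and> (\<lambda>i. - b i) \<in> cone_of d A {..<n} \<longrightarrow> (\<forall>i. b i = 0))"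

definition trivial_pos_kernel :: "nat \<Rightarrow> nat \<Rightarrow> (nat \<Rightarrow> nat \<Rightarrow> int) \<Rightarrow> bool" where
  "trivial_pos_kernel d n A \<longleftrightarrow>
     (\<forall>x::nat \<Rightarrow> real. (\<forall>j<n. x j \<ge> 0) \<and> (\<forall>i<d. (\<Sum>j<n. real_of_int (A i j) * x j) = 0)
        \<longrightarrow> (\<forall>j<n. x j = 0))"

definition lattice_generating :: "nat \<Rightarrow> nat \<Rightarrow> (nat \<Rightarrow> nat \<Rightarrow> int) \<Rightarrow> bool" where
  "lattice_generating d n A \<longleftrightarrow>
     (\<forall>b::nat \<Rightarrow> int. \<exists>z::nat \<Rightarrow> int. \<forall>i<d. b i = (\<Sum>j<n. A i j * z j))"

definition standing_assms :: "nat \<Rightarrow> nat \<Rightarrow> (nat \<Rightarrow> nat \<Rightarrow> int) \<Rightarrow> bool" where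
  "standing_assms d n A \<longleftrightarrow> full_row_rank d n A \<and> pointed_cone d n A \<and>
      trivial_pos_kernel d n A \<and> lattice_generating d n A"

definition NA :: "nat \<Rightarrow> nat \<Rightarrow> (nat \<Rightarrow> nat \<Rightarrow> int) \<Rightarrow> (nat \<Rightarrow> int) set" where
  "NA d n A = {b. (\<forall>i\<ge>d. b i = 0) \<and>
      (\<exists>u::nat \<Rightarrow> nat. \<forall>i<d. b i = (\<Sum>j<n. A i j * int (u j)))}"

definition Delta :: "nat \<Rightarrow> nat \<Rightarrow> (nat \<Rightarrow> nat \<Rightarrow> int) \<Rightarrow> (nat \<Rightarrow> real) \<Rightarrow> nat set set" where
  "Delta d n A c = {\<sigma>. \<sigma> \<subseteq> {..<n} \<and>
      (\<exists>y::nat \<Rightarrow> real. (\<forall>j\<in>\<sigma>. dotc d A y j = c j) \<and>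
                        (\<forall>j\<in>{..<n} - \<sigma>. dotc d A y j < c j))}"

definition is_triangulation :: "nat \<Rightarrow> nat \<Rightarrow> (nat \<Rightarrow> nat \<Rightarrow> int) \<Rightarrow> nat set set \<Rightarrow> bool" where
  "is_triangulation d n A \<Delta> \<longleftrightarrow>
     (\<forall>\<sigma>\<in>\<Delta>. \<sigma> \<subseteq> {..<n}) \<and>
     (\<forall>\<sigma>\<in>\<Delta>. \<forall>x::nat \<Rightarrow> real.
         (\<forall>i<d. (\<Sum>j\<in>\<sigma>. real_of_int (A i j) * x j) = 0) \<longrightarrow> (\<forall>j\<in>\<sigma>. x j = 0)) \<and>
     (\<forall>\<sigma>\<in>\<Delta>. \<forall>\<tau>. \<tau> \<subseteq> \<sigma> \<longrightarrow> \<tau> \<in> \<Delta>) \<and>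
     cone_of d A {..<n} = (\<Union>\<sigma>\<in>\<Delta>. cone_of d A \<sigma>) \<and>
     (\<forall>\<sigma>\<in>\<Delta>. \<forall>\<tau>\<in>\<Delta>. cone_of d A \<sigma> \<inter> cone_of d A \<tau> = cone_of d A (\<sigma> \<inter> \<tau>))"

definition regular_triangulation :: "nat \<Rightarrow> nat \<Rightarrow> (nat \<Rightarrow> nat \<Rightarrow> int) \<Rightarrow> nat set set \<Rightarrow> bool" where
  "regular_triangulation d n A \<Delta> \<longleftrightarrow>
     is_triangulation d n A \<Delta> \<and> (\<exists>c'. \<Delta> = Delta d n A c')"

definition maximal_face :: "nat set set \<Rightarrow> nat set \<Rightarrow> bool" where
  "maximal_face \<Delta> \<sigma> \<longleftrightarrow> \<sigma> \<in> \<Delta> \<and> \<not> (\<exists>\<tau>\<in>\<Delta>. \<sigma> \<subset> \<tau>)"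

definition Delta_normal :: "nat \<Rightarrow> nat \<Rightarrow> (nat \<Rightarrow> nat \<Rightarrow> int) \<Rightarrow> nat set set \<Rightarrow> bool" where
  "Delta_normal d n A \<Delta> \<longleftrightarrow>
     (\<forall>\<sigma>. maximal_face \<Delta> \<sigma> \<longrightarrow>
        (\<forall>b \<in> cone_of d A \<sigma> \<inter> int_points d.
           \<exists>u::nat \<Rightarrow> nat. \<forall>i<d.
              b i = (\<Sum>j\<in>{j. j < n \<and> colv d A j \<in> cone_of d A \<sigma>}. real_of_int (A i j) * real (u j))))"

definition ip_feasible :: "nat \<Rightarrow> nat \<Rightarrow> (nat \<Rightarrow> nat \<Rightarrow> int) \<Rightarrow> (nat \<Rightarrow> int) \<Rightarrow> (nat \<Rightarrow> nat) \<Rightarrow> bool" where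
  "ip_feasible d n A b x \<longleftrightarrow> (\<forall>j\<ge>n. x j = 0) \<and> (\<forall>i<d. (\<Sum>j<n. A i j * int (x j)) = b i)"

definition ip_optimal :: "nat \<Rightarrow> nat \<Rightarrow> (nat \<Rightarrow> nat \<Rightarrow> int) \<Rightarrow> (nat \<Rightarrow> real) \<Rightarrow> (nat \<Rightarrow> int) \<Rightarrow> (nat \<Rightarrow> nat) \<Rightarrow> bool" where
  "ip_optimal d n A c b x \<longleftrightarrow> ip_feasible d n A b x \<and>
     (\<forall>x'. ip_feasible d n A b x' \<longrightarrow> (\<Sum>j<n. c j * real (x j)) \<le> (\<Sum>j<n. c j * real (x' j)))"

definition generic_cost :: "nat \<Rightarrow> nat \<Rightarrow> (nat \<Rightarrow> nat \<Rightarrow> int) \<Rightarrow> (nat \<Rightarrow> real) \<Rightarrow> bool" where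
  "generic_cost d n A c \<longleftrightarrow> is_triangulation d n A (Delta d n A c) \<and>
     (\<forall>b\<in>NA d n A. \<exists>!x. ip_optimal d n A c b x)"

text \<open>Reduced costs: c_sigma A_sigma^{-1} is the unique y (in R^d) with y.a_j = c_j for j in sigma
  (sigma a maximal face, so A_sigma is invertible); tilde c_j = c_j - y . a_j.\<close>
definition dual_point :: "nat \<Rightarrow> (nat \<Rightarrow> nat \<Rightarrow> int) \<Rightarrow> (nat \<Rightarrow> real) \<Rightarrow> nat set \<Rightarrow> nat \<Rightarrow> real" where
  "dual_point d A c \<sigma> = (THE y. (\<forall>i\<ge>d. y i = 0) \<and> (\<forall>j\<in>\<sigma>. dotc d A y j = c j))"

definition reduced_cost :: "nat \<Rightarrow> (nat \<Rightarrow> nat \<Rightarrow> int) \<Rightarrow> (nat \<Rightarrow> real) \<Rightarrow> nat set \<Rightarrow> nat \<Rightarrow> real" where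
  "reduced_cost d A c \<sigma> j = c j - dotc d A (dual_point d A c \<sigma>) j"

definition group_feasible :: "nat \<Rightarrow> nat \<Rightarrow> (nat \<Rightarrow> nat \<Rightarrow> int) \<Rightarrow> nat set \<Rightarrow> (nat \<Rightarrow> int) \<Rightarrow> (nat \<Rightarrow> int) \<Rightarrow> bool" where
  "group_feasible d n A \<sigma> b x \<longleftrightarrow> (\<forall>j\<ge>n. x j = 0) \<and>
     (\<forall>i<d. (\<Sum>j<n. A i j * x j) = b i) \<and> (\<forall>j\<in>{..<n} - \<sigma>. x j \<ge> 0)"

definition group_objective :: "nat \<Rightarrow> nat \<Rightarrow> (nat \<Rightarrow> nat \<Rightarrow> int) \<Rightarrow> (nat \<Rightarrow> real) \<Rightarrow> nat set \<Rightarrow> (nat \<Rightarrow> int) \<Rightarrow> real" where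
  "group_objective d n A c \<sigma> x = (\<Sum>j\<in>{..<n} - \<sigma>. reduced_cost d A c \<sigma> j * real_of_int (x j))"

definition group_optimal :: "nat \<Rightarrow> nat \<Rightarrow> (nat \<Rightarrow> nat \<Rightarrow> int) \<Rightarrow> (nat \<Rightarrow> real) \<Rightarrow> nat set \<Rightarrow> (nat \<Rightarrow> int) \<Rightarrow> (nat \<Rightarrow> int) \<Rightarrow> bool" where
  "group_optimal d n A c \<sigma> b x \<longleftrightarrow> group_feasible d n A \<sigma> b x \<and>
     (\<forall>x'. group_feasible d n A \<sigma> b x' \<longrightarrow> group_objective d n A c \<sigma> x \<le> group_objective d n A c \<sigma> x')"

definition group_solves :: "nat \<Rightarrow> nat \<Rightarrow> (nat \<Rightarrow> nat \<Rightarrow> int) \<Rightarrow> (nat \<Rightarrow> real) \<Rightarrow> nat set \<Rightarrow> (nat \<Rightarrow> int) \<Rightarrow> bool" where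
  "group_solves d n A c \<sigma> b \<longleftrightarrow> (\<exists>x. group_optimal d n A c \<sigma> b x \<and> (\<forall>j. x j \<ge> 0))"

definition gomory_family :: "nat \<Rightarrow> nat \<Rightarrow> (nat \<Rightarrow> nat \<Rightarrow> int) \<Rightarrow> (nat \<Rightarrow> real) \<Rightarrow> bool" where
  "gomory_family d n A c \<longleftrightarrow>
     (\<forall>b\<in>NA d n A. \<exists>\<sigma>. maximal_face (Delta d n A c) \<sigma> \<and> group_solves d n A c \<sigma> b)"

end

(* Let V be the set of vertices of the triangulation. Keep (a scaled, rounded) lift on V, and for
   a column a_j outside V take the cost g(a_j) + M h(a_j) + f_j, where g is the piecewise linear
   extension of the lift and h the piecewise linear function with h = 1 on V. The lift dominates,
   so cheap solutions of the group relaxation at sigma only use columns of cone(A_sigma). For b in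
   cone(A_sigma) with fractional part p (in the fundamental parallelepiped), their columns
   off sigma sum to an element of cone(A_sigma) congruent to p modulo Z A_sigma, that is to p
   plus nonnegative integer multiples of generators, so their h-weight is h(p) plus a natural
   number. The Hilbert basis represents p itself, hence the minimum has exactly the sum p and
   the coordinates on sigma are the integer parts of those of b, which are nonnegative. The
   small superincreasing term f breaks the remaining ties. *)

theory Submission
  imports Defs
begin

section \<open>Functionals on columns, cones, and numeric estimates\<close>

lemma dotc_combination:
  assumes "\<forall>i<d. b i = (\<Sum>j\<in>S. real_of_int (A i j) * x j)"
  shows "(\<Sum>i<d. y i * b i) = (\<Sum>j\<in>S. dotc d A y j * x j)"
proof -
  have "(\<Sum>i<d. y i * b i) = (\<Sum>i<d. \<Sum>j\<in>S. y i * real_of_int (A i j) * x j)"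
    using assms by (intro sum.cong) (auto simp: sum_distrib_left mult.assoc)
  also have "\<dots> = (\<Sum>j\<in>S. \<Sum>i<d. y i * real_of_int (A i j) * x j)"
    by (rule sum.swap)
  also have "\<dots> = (\<Sum>j\<in>S. dotc d A y j * x j)"
    by (simp add: dotc_def sum_distrib_right)
  finally show ?thesis .
qed

lemma dotc_column:
  assumes "\<forall>i<d. real_of_int (A i j) = (\<Sum>k\<in>S. real_of_int (A i k) * x k)"
  shows "dotc d A y j = (\<Sum>k\<in>S. dotc d A y k * x k)"
  using dotc_combination[where b = "\<lambda>i. real_of_int (A i j)" and x = x, OF assms]
  by (simp add: dotc_def)

lemma dotc_add: "dotc d A (\<lambda>i. y i + z i) j = dotc d A y j + dotc d A z j"
  by (simp add: dotc_def algebra_simps sum.distrib)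

lemma dotc_diff: "dotc d A (\<lambda>i. y i - z i) j = dotc d A y j - dotc d A z j"
  by (simp add: dotc_def algebra_simps sum_subtractf)

lemma dotc_scale: "dotc d A (\<lambda>i. t * y i) j = t * dotc d A y j"
  by (simp add: dotc_def sum_distrib_left mult.assoc)

lemma dotc_sum: "dotc d A (\<lambda>i. \<Sum>k\<in>S. t k * z k i) j = (\<Sum>k\<in>S. t k * dotc d A (z k) j)"
proof -
  have "dotc d A (\<lambda>i. \<Sum>k\<in>S. t k * z k i) j
      = (\<Sum>i<d. \<Sum>k\<in>S. t k * (z k i * real_of_int (A i j)))"
    by (simp add: dotc_def sum_distrib_right mult.assoc)
  also have "\<dots> = (\<Sum>k\<in>S. \<Sum>i<d. t k * (z k i * real_of_int (A i j)))"
    by (rule sum.swap)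
  finally show ?thesis
    by (simp add: dotc_def sum_distrib_left)
qed

lemma cone_of_mono:
  assumes "S \<subseteq> T" "finite T"
  shows "cone_of d A S \<subseteq> cone_of d A T"
proof
  fix b assume "b \<in> cone_of d A S"
  then obtain x where x: "\<forall>i\<ge>d. b i = 0" "\<forall>j\<in>S. x j \<ge> (0::real)"
    "\<forall>i<d. b i = (\<Sum>j\<in>S. real_of_int (A i j) * x j)"
    by (auto simp: cone_of_def)
  have "(\<Sum>j\<in>S. real_of_int (A i j) * x j)
      = (\<Sum>j\<in>T. real_of_int (A i j) * (if j \<in> S then x j else 0))" for i
    using assms by (intro sum.mono_neutral_cong_left) auto
  then show "b \<in> cone_of d A T"
    unfolding cone_of_def using x
    by (auto intro!: exI[of _ "\<lambda>j. if j \<in> S then x j else 0"])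
qed

text \<open>\<open>cone_of\<close> constrains coefficients only on \<open>S\<close>; resetting the
  others to zero allows sums over larger index sets.\<close>

lemma cone_of_coeffs:
  assumes "b \<in> cone_of d A S"
  obtains x where "\<forall>j. x j \<ge> (0::real)" "\<forall>j. j \<notin> S \<longrightarrow> x j = 0"
    "\<forall>i<d. b i = (\<Sum>j\<in>S. real_of_int (A i j) * x j)"
proof -
  from assms obtain x where x: "\<forall>j\<in>S. x j \<ge> (0::real)"
    "\<forall>i<d. b i = (\<Sum>j\<in>S. real_of_int (A i j) * x j)"
    by (auto simp: cone_of_def)
  show ?thesis
    by (rule that[of "\<lambda>j. if j \<in> S then x j else 0"]) (use x in auto)
qed

lemma colv_in_cone_of_member:
  assumes "j \<in> S" "finite S"
  shows "colv d A j \<in> cone_of d A S"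
proof -
  have "(\<Sum>k\<in>S. real_of_int (A i k) * (if k = j then 1 else 0)) = real_of_int (A i j)" for i
    using assms by (simp add: if_distrib cong: if_cong)
  then show ?thesis
    unfolding cone_of_def colv_def
    by (auto intro!: exI[of _ "\<lambda>k. if k = j then 1 else 0"])
qed

text \<open>Argue from the top index down: the last weight exceeds all that the lower terms can
  contribute, so the integer there has absolute value below 1. Applied to the difference of two
  optimal solutions.\<close>

lemma superincreasing_zero:
  fixes f :: "nat \<Rightarrow> real" and z :: "nat \<Rightarrow> int"
  assumes "\<And>j. f j > B * (\<Sum>i<j. f i)" "\<And>j. f j > 0" "B \<ge> 0"
    and "\<And>j. j < n \<Longrightarrow> real_of_int \<bar>z j\<bar> \<le> B"
    and "(\<Sum>j<n. f j * real_of_int (z j)) = 0"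
  shows "\<forall>j<n. z j = 0"
  using assms(4,5)
proof (induction n)
  case (Suc n)
  have "\<bar>\<Sum>j<n. f j * real_of_int (z j)\<bar> \<le> (\<Sum>j<n. \<bar>f j * real_of_int (z j)\<bar>)"
    by (rule sum_abs)
  also have "\<dots> \<le> (\<Sum>j<n. B * f j)"
  proof (rule sum_mono)
    fix j assume "j \<in> {..<n}"
    then have "real_of_int \<bar>z j\<bar> \<le> B" using Suc.prems(1)[of j] by simp
    then have "f j * real_of_int \<bar>z j\<bar> \<le> f j * B"
      using assms(2)[of j] by (intro mult_left_mono) auto
    then show "\<bar>f j * real_of_int (z j)\<bar> \<le> B * f j"
      using assms(2)[of j] by (simp add: abs_mult mult.commute)
  qed
  also have "\<dots> < f n" using assms(1)[of n] by (simp add: sum_distrib_left)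
  finally have less: "\<bar>\<Sum>j<n. f j * real_of_int (z j)\<bar> < f n" .
  moreover have "f n * real_of_int (z n) = - (\<Sum>j<n. f j * real_of_int (z j))"
    using Suc.prems(2) by simp
  ultimately have "\<bar>f n * real_of_int (z n)\<bar> < f n * 1" by simp
  then have "\<bar>real_of_int (z n)\<bar> < 1"
    using assms(2)[of n] by (simp add: abs_mult)
  then have "z n = 0" by linarith
  moreover have "\<forall>j<n. z j = 0"
  proof (rule Suc.IH)
    show "real_of_int \<bar>z j\<bar> \<le> B" if "j < n" for j
      by (rule Suc.prems(1)) (use that in simp)
    show "(\<Sum>j<n. f j * real_of_int (z j)) = 0"
      using Suc.prems(2) \<open>z n = 0\<close> by simp
  qed
  ultimately show ?case by (auto simp: less_Suc_eq)
qed simp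

text \<open>With ratio \<open>2 * b + 1\<close> the geometric sum telescopes to
  \<open>(2 * b + 1) ^ j - 1\<close>. The factor 2 leaves room for a tie-break rounded up by at most
  1 from a power that is at least 1.\<close>

lemma sum_shifted_powers:
  assumes "b \<ge> (0::real)" and "\<And>j. f j \<le> 2 * (2 * b + 1) ^ j"
  shows "b * (\<Sum>i<j. f i) < (2 * b + 1) ^ j"
proof -
  have "b * (\<Sum>i<j. f i) \<le> b * (\<Sum>i<j. 2 * (2 * b + 1) ^ i)"
    using assms by (intro mult_left_mono sum_mono) auto
  also have "\<dots> = (2 * b + 1) ^ j - 1"
    by (induction j) (simp_all add: algebra_simps)
  finally show ?thesis by simp
qed

text \<open>The right side is linear in \<open>N\<close> with positive slope. Stated with a filter
  so that finitely many such bounds can be met by one \<open>N\<close>.\<close>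

lemma eventually_gap:
  fixes r :: real
  assumes "g > (0::real)" "a > (0::real)"
  shows "\<forall>\<^sub>F N in sequentially. r < a * (real N * g - t)"
proof -
  obtain m where m: "(r / a + t) / g < real m" using reals_Archimedean2 by blast
  have "r < a * (real N * g - t)" if "m \<le> N" for N
  proof -
    have "(r / a + t) / g < real N" using m that by linarith
    then have "r / a < real N * g - t" using assms(1) by (simp add: pos_divide_less_eq)
    then show ?thesis using assms(2) by (simp add: pos_divide_less_eq mult.commute)
  qed
  then show ?thesis unfolding eventually_sequentially by blast
qed

section \<open>Regular triangulations and their support vectors\<close>

text \<open>The support vectors are parameters, so the same theory serves twice: for the given real
  lift, and later for the integer cost with its own support vectors.\<close>

locale supported_triangulation =
  fixes d n :: nat and A :: "nat \<Rightarrow> nat \<Rightarrow> int" and \<Delta> :: "nat set set"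
    and w :: "nat \<Rightarrow> real" and Y :: "nat set \<Rightarrow> nat \<Rightarrow> real"
  assumes triangulation: "is_triangulation d n A \<Delta>"
    and Y_tight: "\<And>\<sigma> j. \<sigma> \<in> \<Delta> \<Longrightarrow> j \<in> \<sigma> \<Longrightarrow> dotc d A (Y \<sigma>) j = w j"
    and Y_strict: "\<And>\<sigma> j. \<sigma> \<in> \<Delta> \<Longrightarrow> j < n \<Longrightarrow> j \<notin> \<sigma> \<Longrightarrow> dotc d A (Y \<sigma>) j < w j"
    and column_nonzero: "\<And>j. j < n \<Longrightarrow> \<exists>i<d. A i j \<noteq> 0"
begin

lemma face_subset: "\<sigma> \<in> \<Delta> \<Longrightarrow> \<sigma> \<subseteq> {..<n}"
  using triangulation by (auto simp: is_triangulation_def)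

lemma finite_face: "\<sigma> \<in> \<Delta> \<Longrightarrow> finite \<sigma>"
  using face_subset finite_subset by blast

lemma face_less: "\<sigma> \<in> \<Delta> \<Longrightarrow> j \<in> \<sigma> \<Longrightarrow> j < n"
  using face_subset by blast

lemma finite_faces: "finite \<Delta>"
proof -
  have "\<Delta> \<subseteq> Pow {..<n}" using face_subset by blast
  then show ?thesis by (rule finite_subset) simp
qed

lemma subface: "\<sigma> \<in> \<Delta> \<Longrightarrow> \<tau> \<subseteq> \<sigma> \<Longrightarrow> \<tau> \<in> \<Delta>"
  using triangulation by (auto simp: is_triangulation_def)

lemma cone_Int:
  "\<sigma> \<in> \<Delta> \<Longrightarrow> \<tau> \<in> \<Delta> \<Longrightarrow> cone_of d A \<sigma> \<inter> cone_of d A \<tau> = cone_of d A (\<sigma> \<inter> \<tau>)"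
  using triangulation by (auto simp: is_triangulation_def)

lemma face_cover: "b \<in> cone_of d A {..<n} \<Longrightarrow> \<exists>\<sigma>\<in>\<Delta>. b \<in> cone_of d A \<sigma>"
  using triangulation by (auto simp: is_triangulation_def)

text \<open>The support vectors of a face and of its facets already provide a dual basis.\<close>

definition dual :: "nat set \<Rightarrow> nat \<Rightarrow> nat \<Rightarrow> real" where
  "dual \<sigma> i = (\<lambda>k. inverse (w i - dotc d A (Y (\<sigma> - {i})) i) * (Y \<sigma> k - Y (\<sigma> - {i}) k))"

text \<open>Both support vectors are tight on the facet and only \<open>Y \<sigma>\<close> is tight
  at \<open>i\<close>; their difference vanishes on the facet, and the factor in \<open>dual\<close>
  normalises its value at \<open>i\<close>.\<close>

lemma dual_basis:
  assumes "\<sigma> \<in> \<Delta>" "i \<in> \<sigma>" "k \<in> \<sigma>"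
  shows "dotc d A (dual \<sigma> i) k = (if k = i then 1 else 0)"
proof -
  have face: "\<sigma> - {i} \<in> \<Delta>" using subface[OF assms(1)] by blast
  have "dotc d A (Y (\<sigma> - {i})) i < w i"
    using Y_strict[OF face] face_less[OF assms(1,2)] by blast
  moreover have "dotc d A (Y (\<sigma> - {i})) k = w k" if "k \<noteq> i"
    using Y_tight[OF face] assms(3) that by blast
  ultimately show ?thesis
    unfolding dual_def dotc_scale dotc_diff using Y_tight[OF assms(1)] assms by auto
qed

text \<open>Makes representations over a face unique.\<close>

lemma dual_coeff:
  assumes "\<sigma> \<in> \<Delta>" "i \<in> \<sigma>" "\<forall>m<d. b m = (\<Sum>k\<in>\<sigma>. real_of_int (A m k) * x k)"
  shows "(\<Sum>m<d. dual \<sigma> i m * b m) = x i"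
proof -
  have "(\<Sum>m<d. dual \<sigma> i m * b m) = (\<Sum>k\<in>\<sigma>. dotc d A (dual \<sigma> i) k * x k)"
    by (rule dotc_combination[OF assms(3)])
  also have "\<dots> = (\<Sum>k\<in>\<sigma>. if k = i then x k else 0)"
    by (rule sum.cong) (auto simp: dual_basis[OF assms(1,2)])
  also have "\<dots> = x i" using assms finite_face by simp
  finally show ?thesis .
qed

text \<open>Nonnegative coordinates of a column with respect to a face containing it. They do not
  depend on the choice of the face, since cones of faces meet in cones of common faces.\<close>

definition coord :: "nat \<Rightarrow> nat \<Rightarrow> real" where
  "coord j = (SOME l. \<exists>\<sigma>\<in>\<Delta>. (\<forall>k. l k \<ge> 0) \<and> (\<forall>k. k \<notin> \<sigma> \<longrightarrow> l k = 0) \<and>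
      (\<forall>i<d. real_of_int (A i j) = (\<Sum>k\<in>\<sigma>. real_of_int (A i k) * l k)))"

lemma coord_face:
  assumes "j < n"
  shows "\<exists>\<sigma>\<in>\<Delta>. (\<forall>k. coord j k \<ge> 0) \<and> (\<forall>k. k \<notin> \<sigma> \<longrightarrow> coord j k = 0) \<and>
      (\<forall>i<d. real_of_int (A i j) = (\<Sum>k\<in>\<sigma>. real_of_int (A i k) * coord j k))"
proof -
  have "colv d A j \<in> cone_of d A {..<n}"
    using assms by (intro colv_in_cone_of_member) auto
  then obtain \<sigma> where \<sigma>: "\<sigma> \<in> \<Delta>" "colv d A j \<in> cone_of d A \<sigma>"
    using face_cover by blast
  from \<sigma>(2) obtain x where "\<forall>k. x k \<ge> (0::real)" "\<forall>k. k \<notin> \<sigma> \<longrightarrow> x k = 0"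
    "\<forall>i<d. colv d A j i = (\<Sum>k\<in>\<sigma>. real_of_int (A i k) * x k)"
    by (rule cone_of_coeffs)
  then have "\<exists>l. \<exists>\<sigma>\<in>\<Delta>. (\<forall>k. l k \<ge> 0) \<and> (\<forall>k. k \<notin> \<sigma> \<longrightarrow> l k = 0) \<and>
      (\<forall>i<d. real_of_int (A i j) = (\<Sum>k\<in>\<sigma>. real_of_int (A i k) * l k))"
    using \<sigma>(1) by (intro exI[of _ x] bexI[of _ \<sigma>]) (auto simp: colv_def)
  then show ?thesis unfolding coord_def by (rule someI_ex)
qed

lemma coord_nonneg: "j < n \<Longrightarrow> coord j k \<ge> 0"
  using coord_face by blast

text \<open>The coordinates vanish off the chosen face, so the sum may run over all indices and no
  face has to be named.\<close>

lemma coord_expansion: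
  assumes "j < n"
  shows "dotc d A y j = (\<Sum>k<n. dotc d A y k * coord j k)"
proof -
  obtain \<sigma> where \<sigma>: "\<sigma> \<in> \<Delta>" "\<forall>k. k \<notin> \<sigma> \<longrightarrow> coord j k = 0"
    "\<forall>i<d. real_of_int (A i j) = (\<Sum>k\<in>\<sigma>. real_of_int (A i k) * coord j k)"
    using coord_face[OF assms] by blast
  have "dotc d A y j = (\<Sum>k\<in>\<sigma>. dotc d A y k * coord j k)"
    by (rule dotc_column[OF \<sigma>(3)])
  also have "\<dots> = (\<Sum>k<n. dotc d A y k * coord j k)"
    using \<sigma> face_subset by (intro sum.mono_neutral_left) auto
  finally show ?thesis .
qed

lemma coord_in_cone:
  assumes "j < n" "\<sigma> \<in> \<Delta>" "colv d A j \<in> cone_of d A \<sigma>" "k \<notin> \<sigma>"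
  shows "coord j k = 0"
proof -
  obtain \<tau> where \<tau>: "\<tau> \<in> \<Delta>" "\<forall>k. coord j k \<ge> 0" "\<forall>k. k \<notin> \<tau> \<longrightarrow> coord j k = 0"
    "\<forall>i<d. real_of_int (A i j) = (\<Sum>k\<in>\<tau>. real_of_int (A i k) * coord j k)"
    using coord_face[OF assms(1)] by blast
  have "colv d A j \<in> cone_of d A \<tau>"
    using \<tau> by (auto simp: cone_of_def colv_def)
  then have "colv d A j \<in> cone_of d A (\<tau> \<inter> \<sigma>)"
    using cone_Int \<tau>(1) assms(2,3) by blast
  then obtain x where x: "\<forall>k. k \<notin> \<tau> \<inter> \<sigma> \<longrightarrow> x k = (0::real)"
    "\<forall>i<d. colv d A j i = (\<Sum>k\<in>\<tau> \<inter> \<sigma>. real_of_int (A i k) * x k)"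
    by (rule cone_of_coeffs)
  \<comment> \<open>Padded by zeros, the expansion over the common face becomes one over
    \<open>\<tau>\<close>, where the dual basis forces it to agree with
    \<open>coord j\<close>.\<close>
  have x': "\<forall>i<d. real_of_int (A i j) = (\<Sum>k\<in>\<tau>. real_of_int (A i k) * x k)"
  proof (intro allI impI)
    fix i assume "i < d"
    then have "real_of_int (A i j) = (\<Sum>k\<in>\<tau> \<inter> \<sigma>. real_of_int (A i k) * x k)"
      using x(2) by (simp add: colv_def)
    also have "\<dots> = (\<Sum>k\<in>\<tau>. real_of_int (A i k) * x k)"
      using finite_face[OF \<tau>(1)] x(1) by (intro sum.mono_neutral_left) auto
    finally show "real_of_int (A i j) = \<dots>" .
  qed
  show ?thesis
  proof (cases "k \<in> \<tau>")
    case True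
    have "coord j k = x k"
      using dual_coeff[OF \<tau>(1) True \<tau>(4)] dual_coeff[OF \<tau>(1) True x'] by simp
    then show ?thesis using x(1) assms(4) by simp
  qed (use \<tau> in simp)
qed

text \<open>Used in contrapositive form: a column outside the cone has a nonzero coordinate at some
  \<open>k\<close> off the face, and this coordinate will pay for leaving the cone.\<close>

lemma in_cone_if_coord:
  assumes "j < n" "\<sigma> \<in> \<Delta>" "\<And>k. k < n \<Longrightarrow> k \<notin> \<sigma> \<Longrightarrow> coord j k = 0"
  shows "colv d A j \<in> cone_of d A \<sigma>"
proof -
  obtain \<tau> where \<tau>: "\<tau> \<in> \<Delta>" "\<forall>k. coord j k \<ge> 0" "\<forall>k. k \<notin> \<tau> \<longrightarrow> coord j k = 0"
    "\<forall>i<d. real_of_int (A i j) = (\<Sum>k\<in>\<tau>. real_of_int (A i k) * coord j k)"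
    using coord_face[OF assms(1)] by blast
  have "(\<Sum>k\<in>\<tau>. real_of_int (A i k) * coord j k) = (\<Sum>k\<in>\<sigma>. real_of_int (A i k) * coord j k)" for i
    using \<tau> assms finite_face face_less by (intro sum.mono_neutral_cong) auto
  then show ?thesis
    using \<tau> by (auto simp: cone_of_def colv_def)
qed

lemma dual_column:
  assumes "j < n" "\<sigma> \<in> \<Delta>" "colv d A j \<in> cone_of d A \<sigma>" "i \<in> \<sigma>"
  shows "dotc d A (dual \<sigma> i) j = coord j i"
proof -
  have "dotc d A (dual \<sigma> i) j = (\<Sum>k<n. dotc d A (dual \<sigma> i) k * coord j k)"
    by (rule coord_expansion[OF assms(1)])
  also have "\<dots> = (\<Sum>k<n. if k = i then coord j k else 0)"
  proof (rule sum.cong)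
    fix k
    show "dotc d A (dual \<sigma> i) k * coord j k = (if k = i then coord j k else 0)"
      using coord_in_cone[OF assms(1-3), of k] dual_basis[OF assms(2,4), of k] assms(4)
      by (cases "k \<in> \<sigma>") auto
  qed simp
  also have "\<dots> = coord j i" using face_less[OF assms(2,4)] by simp
  finally show ?thesis .
qed

text \<open>A vertex lies on its own ray, the cone of the face \<open>{j}\<close>.\<close>

lemma coord_vertex:
  assumes "j \<in> \<Union>\<Delta>"
  shows "coord j k = (if k = j then 1 else 0)"
proof -
  obtain \<sigma> where "\<sigma> \<in> \<Delta>" "j \<in> \<sigma>" using assms by blast
  then have j: "j < n" "{j} \<in> \<Delta>" using face_less subface[of \<sigma> "{j}"] by auto
  have cone: "colv d A j \<in> cone_of d A {j}" by (rule colv_in_cone_of_member) auto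
  show ?thesis
  proof (cases "k = j")
    case True
    then show ?thesis using dual_column[OF j cone, of j] dual_basis[OF j(2), of j j] by simp
  next
    case False
    then show ?thesis using coord_in_cone[OF j cone, of k] by simp
  qed
qed

text \<open>The value at a column of the piecewise linear function on the fan that is 1 at every
  vertex.\<close>

definition height :: "nat \<Rightarrow> real" where
  "height j = (\<Sum>k<n. coord j k)"

text \<open>The coordinates are nonnegative, so height zero would force the column itself to be
  zero.\<close>

lemma height_pos:
  assumes "j < n"
  shows "height j > 0"
proof -
  have "height j \<noteq> 0"
  proof
    assume "height j = 0"
    then have "\<forall>k<n. coord j k = 0"
      using coord_nonneg[OF assms] sum_nonneg_eq_0_iff[of "{..<n}" "coord j"]
      by (simp add: height_def)
    moreover obtain \<sigma> where "\<sigma> \<in> \<Delta>"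
      "\<forall>i<d. real_of_int (A i j) = (\<Sum>k\<in>\<sigma>. real_of_int (A i k) * coord j k)"
      using coord_face[OF assms] by blast
    ultimately have "\<forall>i<d. real_of_int (A i j) = 0"
      using face_less by simp
    then show False using column_nonzero[OF assms] by auto
  qed
  moreover have "height j \<ge> 0"
    unfolding height_def using coord_nonneg[OF assms] by (intro sum_nonneg) auto
  ultimately show ?thesis by simp
qed

section \<open>Maximal faces and recovery of the triangulation from its lift\<close>

lemma maximal_above:
  assumes "\<sigma> \<in> \<Delta>"
  shows "\<exists>\<tau>. maximal_face \<Delta> \<tau> \<and> \<sigma> \<subseteq> \<tau>"
proof -
  obtain \<tau> where "\<tau> \<in> \<Delta>" "\<sigma> \<subseteq> \<tau>" "\<forall>\<rho>\<in>\<Delta>. \<tau> \<subseteq> \<rho> \<longrightarrow> \<tau> = \<rho>"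
    using finite_has_maximal2[OF finite_faces assms] by blast
  then show ?thesis unfolding maximal_face_def by blast
qed

lemma maximal_cover:
  assumes "b \<in> cone_of d A {..<n}"
  shows "\<exists>\<sigma>. maximal_face \<Delta> \<sigma> \<and> b \<in> cone_of d A \<sigma>"
proof -
  obtain \<sigma> where "\<sigma> \<in> \<Delta>" "b \<in> cone_of d A \<sigma>" using face_cover[OF assms] by blast
  moreover obtain \<tau> where "maximal_face \<Delta> \<tau>" "\<sigma> \<subseteq> \<tau>"
    using maximal_above[OF \<open>\<sigma> \<in> \<Delta>\<close>] by blast
  moreover have "finite \<tau>"
    using \<open>maximal_face \<Delta> \<tau>\<close> finite_face unfolding maximal_face_def by blast
  ultimately show ?thesis using cone_of_mono by blast
qed

lemma Delta_eq: "Delta d n A w = \<Delta>"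
proof
  show "\<Delta> \<subseteq> Delta d n A w"
    using Y_tight Y_strict face_subset unfolding Delta_def by blast
  show "Delta d n A w \<subseteq> \<Delta>"
  \<comment> \<open>Test both support vectors on the sum of the columns of the given set.\<close>
  proof
    fix \<sigma> assume "\<sigma> \<in> Delta d n A w"
    then obtain y where \<sigma>: "\<sigma> \<subseteq> {..<n}" and tight: "\<forall>j\<in>\<sigma>. dotc d A y j = w j"
      and strict: "\<forall>j\<in>{..<n} - \<sigma>. dotc d A y j < w j"
      unfolding Delta_def by blast
    have fin: "finite \<sigma>" using \<sigma> by (rule finite_subset) simp
    define b :: "nat \<Rightarrow> real" where "b = (\<lambda>i. if i < d then \<Sum>j\<in>\<sigma>. real_of_int (A i j) else 0)"
    have b: "\<forall>i<d. b i = (\<Sum>j\<in>\<sigma>. real_of_int (A i j) * 1)" by (simp add: b_def)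
    have "b \<in> cone_of d A \<sigma>"
      unfolding cone_of_def b_def by (auto intro!: exI[of _ "\<lambda>_. 1"])
    then have "b \<in> cone_of d A {..<n}" using cone_of_mono[OF \<sigma>] by auto
    then obtain \<tau> where \<tau>: "\<tau> \<in> \<Delta>" "b \<in> cone_of d A \<tau>" using face_cover by blast
    from \<tau>(2) obtain x where x: "\<forall>j. x j \<ge> (0::real)"
      "\<forall>i<d. b i = (\<Sum>j\<in>\<tau>. real_of_int (A i j) * x j)"
      by (rule cone_of_coeffs)
    have le: "dotc d A y j \<le> w j" if "j < n" for j
      using that tight strict by (cases "j \<in> \<sigma>") (auto simp: less_imp_le)
    have le\<tau>: "dotc d A (Y \<tau>) j \<le> w j" if "j < n" for j
      using that Y_tight[OF \<tau>(1), of j] Y_strict[OF \<tau>(1), of j] by (cases "j \<in> \<tau>") auto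
    \<comment> \<open>Rewrite the pairing with \<open>b\<close> over \<open>\<tau>\<close>, where
      \<open>y\<close> is at most \<open>w\<close> and \<open>Y \<tau>\<close> equals
      \<open>w\<close>, then return to \<open>\<sigma>\<close>.\<close>
    have "(\<Sum>j\<in>\<sigma>. w j) = (\<Sum>j\<in>\<sigma>. dotc d A y j * 1)" using tight by simp
    also have "\<dots> = (\<Sum>j\<in>\<tau>. dotc d A y j * x j)"
      using dotc_combination[OF b, of y] dotc_combination[OF x(2), of y] by simp
    also have "\<dots> \<le> (\<Sum>j\<in>\<tau>. dotc d A (Y \<tau>) j * x j)"
      using le x(1) Y_tight[OF \<tau>(1)] face_less[OF \<tau>(1)]
      by (intro sum_mono mult_right_mono) auto
    also have "\<dots> = (\<Sum>j\<in>\<sigma>. dotc d A (Y \<tau>) j * 1)"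
      using dotc_combination[OF b, of "Y \<tau>"] dotc_combination[OF x(2), of "Y \<tau>"] by simp
    finally have sum_le: "(\<Sum>j\<in>\<sigma>. w j) \<le> (\<Sum>j\<in>\<sigma>. dotc d A (Y \<tau>) j)" by simp
    have "\<sigma> \<subseteq> \<tau>"
    proof (rule ccontr)
      assume "\<not> \<sigma> \<subseteq> \<tau>"
      then obtain j where j: "j \<in> \<sigma>" "j \<notin> \<tau>" by blast
      have "(\<Sum>j\<in>\<sigma>. dotc d A (Y \<tau>) j) < (\<Sum>j\<in>\<sigma>. w j)"
      proof (rule sum_strict_mono_ex1[OF fin])
        show "\<forall>k\<in>\<sigma>. dotc d A (Y \<tau>) k \<le> w k" using le\<tau> \<sigma> by blast
        show "\<exists>k\<in>\<sigma>. dotc d A (Y \<tau>) k < w k"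
          using Y_strict[OF \<tau>(1) _ j(2)] j(1) \<sigma> by blast
      qed
      then show False using sum_le by simp
    qed
    then show "\<sigma> \<in> \<Delta>" by (rule subface[OF \<tau>(1)])
  qed
qed

text \<open>A functional vanishing on a maximal face but not on all columns could be added to the
  support vector until a further column becomes tight.\<close>

lemma maximal_face_no_positive:
  assumes "maximal_face \<Delta> \<sigma>" "\<And>j. j \<in> \<sigma> \<Longrightarrow> dotc d A z j = 0" "j < n"
  shows "dotc d A z j \<le> 0"
proof (rule ccontr)
  assume pos: "\<not> dotc d A z j \<le> 0"
  have \<sigma>: "\<sigma> \<in> \<Delta>" using assms(1) by (simp add: maximal_face_def)
  define P where "P = {k. k < n \<and> dotc d A z k > 0}"
  \<comment> \<open>Ratio test: \<open>ratio k\<close> is the step along \<open>z\<close> at which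
    column \<open>k\<close> becomes tight. The least one over \<open>P\<close> is the longest step
    keeping the functional below \<open>w\<close>.\<close>
  define ratio where "ratio k = (w k - dotc d A (Y \<sigma>) k) / dotc d A z k" for k
  have P: "finite P" "P \<noteq> {}" using pos assms(3) by (auto simp: P_def)
  obtain m where m: "m \<in> P" "\<And>k. k \<in> P \<Longrightarrow> ratio m \<le> ratio k"
    using ex_min_if_finite[of "ratio ` P"] P by (force simp: not_less)
  have m_off: "m \<notin> \<sigma>" "m < n" using m(1) assms(2) by (auto simp: P_def)
  have ratio_pos: "ratio m > 0"
    using m(1) Y_strict[OF \<sigma> m_off(2,1)] by (simp add: ratio_def P_def)
  define y where "y = (\<lambda>i. Y \<sigma> i + ratio m * z i)"
  have y: "dotc d A y k = dotc d A (Y \<sigma>) k + ratio m * dotc d A z k" for k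
    unfolding y_def dotc_add dotc_scale ..
  have y_le: "dotc d A y k \<le> w k" if "k < n" for k
  proof (cases "k \<in> P")
    case True
    then have "ratio m * dotc d A z k \<le> ratio k * dotc d A z k"
      using m(2) by (intro mult_right_mono) (auto simp: P_def)
    also have "\<dots> = w k - dotc d A (Y \<sigma>) k" using True by (simp add: ratio_def P_def)
    finally show ?thesis by (simp add: y)
  next
    case False
    then have "ratio m * dotc d A z k \<le> 0"
      using ratio_pos that by (intro mult_nonneg_nonpos) (auto simp: P_def)
    moreover have "dotc d A (Y \<sigma>) k \<le> w k"
      using that Y_tight[OF \<sigma>, of k] Y_strict[OF \<sigma>, of k] by (cases "k \<in> \<sigma>") auto
    ultimately show ?thesis by (simp add: y)
  qed
  define \<tau> where "\<tau> = {k. k < n \<and> dotc d A y k = w k}"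
  have "\<tau> \<in> Delta d n A w"
    unfolding Delta_def \<tau>_def using y_le by (auto intro!: exI[of _ y] simp: order_less_le)
  then have "\<tau> \<in> \<Delta>" by (simp add: Delta_eq)
  moreover have "\<sigma> \<subseteq> \<tau>"
    using assms(2) Y_tight[OF \<sigma>] face_less[OF \<sigma>] by (auto simp: \<tau>_def y)
  moreover have "m \<in> \<tau>"
    using m(1) by (simp add: \<tau>_def y ratio_def P_def)
  ultimately show False
    using assms(1) m_off(1) unfolding maximal_face_def by blast
qed

text \<open>Apply the one-sided bound to \<open>z\<close> and to its negative; full rank does the
  rest. The columns of a maximal face thus span, which gives uniqueness in
  \<open>dual_point\<close>.\<close>

lemma maximal_face_spanning:
  assumes "full_row_rank d n A" "maximal_face \<Delta> \<sigma>" "\<And>j. j \<in> \<sigma> \<Longrightarrow> dotc d A z j = 0" "i < d"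
  shows "z i = 0"
proof -
  have neg: "dotc d A (\<lambda>i. - z i) j = - dotc d A z j" for j
    using dotc_scale[of d A "- 1" z j] by simp
  have "dotc d A z j = 0" if "j < n" for j
    using maximal_face_no_positive[OF assms(2), of z j]
      maximal_face_no_positive[OF assms(2), of "\<lambda>i. - z i" j] assms(3) that
    by (simp add: neg)
  then show ?thesis using assms(1,4) by (simp add: full_row_rank_def)
qed

lemma reduced_cost_eq:
  assumes "full_row_rank d n A" "maximal_face \<Delta> \<sigma>"
  shows "reduced_cost d A w \<sigma> j = w j - dotc d A (Y \<sigma>) j"
proof -
  have \<sigma>: "\<sigma> \<in> \<Delta>" using assms(2) by (simp add: maximal_face_def)
  \<comment> \<open>\<open>dual_point\<close> asks for zeros from coordinate \<open>d\<close> on,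
    which \<open>Y \<sigma>\<close> need not have.\<close>
  define y where "y = (\<lambda>i. if i < d then Y \<sigma> i else 0)"
  have y: "dotc d A y j = dotc d A (Y \<sigma>) j" for j
    by (simp add: dotc_def y_def)
  have "dual_point d A w \<sigma> = y"
    unfolding dual_point_def
  proof (rule the_equality)
    show "(\<forall>i\<ge>d. y i = 0) \<and> (\<forall>j\<in>\<sigma>. dotc d A y j = w j)"
      using Y_tight[OF \<sigma>] by (simp add: y) (simp add: y_def)
  next
    fix y' assume y': "(\<forall>i\<ge>d. y' i = 0) \<and> (\<forall>j\<in>\<sigma>. dotc d A y' j = w j)"
    have "y' i - Y \<sigma> i = 0" if "i < d" for i
      using y' Y_tight[OF \<sigma>]
      by (intro maximal_face_spanning[OF assms, of "\<lambda>i. y' i - Y \<sigma> i"]) (auto simp: dotc_diff that)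
    with y' show "y' = y" by (auto simp: y_def)
  qed
  then show ?thesis by (simp add: reduced_cost_def y)
qed

section \<open>Integer costs\<close>

text \<open>Scale the lift by a large \<open>N\<close> and round it at the vertices; repair the
  support vectors with the dual bases. At other columns add \<open>M * height j + K ^ j\<close> to
  the piecewise linear extension and round up, leaving the rounding error to \<open>f\<close>. For
  large \<open>N\<close> every column outside the cone of a face has reduced cost above
  \<open>r\<close> there.\<close>

lemma integer_costs:
  fixes K M r :: real
  assumes "K \<ge> 0" "M \<ge> 0" "r \<ge> 0"
  obtains c :: "nat \<Rightarrow> int" and f :: "nat \<Rightarrow> real" and Z :: "nat set \<Rightarrow> nat \<Rightarrow> real" where
    "\<And>j. K ^ j \<le> f j" "\<And>j. f j \<le> K ^ j + 1"
    "\<And>\<sigma> j. \<sigma> \<in> \<Delta> \<Longrightarrow> j \<in> \<sigma> \<Longrightarrow> dotc d A (Z \<sigma>) j = real_of_int (c j)"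
    "\<And>\<sigma> j. \<sigma> \<in> \<Delta> \<Longrightarrow> j < n \<Longrightarrow> j \<notin> \<sigma> \<Longrightarrow> colv d A j \<in> cone_of d A \<sigma>
       \<Longrightarrow> real_of_int (c j) - dotc d A (Z \<sigma>) j = M * height j + f j"
    "\<And>\<sigma> j. \<sigma> \<in> \<Delta> \<Longrightarrow> j < n \<Longrightarrow> colv d A j \<notin> cone_of d A \<sigma>
       \<Longrightarrow> real_of_int (c j) - dotc d A (Z \<sigma>) j > r"
proof -
  \<comment> \<open>Bound on the loss by rounding: 1 for the floor at \<open>k\<close>, and the
    effect at \<open>k\<close> of moving each vertex value of \<open>\<sigma>\<close> by at most
    1.\<close>
  define t where "t \<sigma> k = 1 + (\<Sum>i\<in>\<sigma>. \<bar>dotc d A (dual \<sigma> i) k\<bar>)" for \<sigma> k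
  have "\<forall>\<^sub>F N in sequentially. \<forall>\<sigma>\<in>\<Delta>. \<forall>j\<in>{..<n}. \<forall>k\<in>{..<n}. coord j k > 0 \<longrightarrow> k \<notin> \<sigma> \<longrightarrow>
      r < coord j k * (real N * (w k - dotc d A (Y \<sigma>) k) - t \<sigma> k)"
  proof (intro eventually_ball_finite ballI finite_faces finite_lessThan)
    fix \<sigma> j k assume "\<sigma> \<in> \<Delta>" "j \<in> {..<n}" "k \<in> {..<n}"
    then show "\<forall>\<^sub>F N in sequentially. coord j k > 0 \<longrightarrow> k \<notin> \<sigma> \<longrightarrow>
      r < coord j k * (real N * (w k - dotc d A (Y \<sigma>) k) - t \<sigma> k)"
      using Y_strict[of \<sigma> k] eventually_gap[of "w k - dotc d A (Y \<sigma>) k" "coord j k"]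
      by (cases "coord j k > 0 \<and> k \<notin> \<sigma>") auto
  qed
  then obtain N where N: "\<And>\<sigma> j k. \<sigma> \<in> \<Delta> \<Longrightarrow> j < n \<Longrightarrow> k < n \<Longrightarrow> coord j k > 0 \<Longrightarrow> k \<notin> \<sigma> \<Longrightarrow>
      r < coord j k * (real N * (w k - dotc d A (Y \<sigma>) k) - t \<sigma> k)"
    unfolding eventually_sequentially by blast
  define v where "v k = \<lfloor>real N * w k\<rfloor>" for k
  define S where "S j = (\<Sum>k<n. real_of_int (v k) * coord j k)" for j
  define c where "c j = (if j \<in> \<Union>\<Delta> then v j else \<lceil>S j + M * height j + K ^ j\<rceil>)" for j
  define f where "f j = real_of_int \<lceil>S j + M * height j + K ^ j\<rceil> - (S j + M * height j)" for j
  \<comment> \<open>The dual basis shifts the values of the scaled support vector on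
    \<open>\<sigma>\<close> to the rounded ones.\<close>
  define Z where "Z \<sigma> = (\<lambda>m. real N * Y \<sigma> m
      + (\<Sum>i\<in>\<sigma>. (real_of_int (v i) - real N * w i) * dual \<sigma> i m))" for \<sigma>
  have Z: "dotc d A (Z \<sigma>) j = real N * dotc d A (Y \<sigma>) j
      + (\<Sum>i\<in>\<sigma>. (real_of_int (v i) - real N * w i) * dotc d A (dual \<sigma> i) j)" for \<sigma> j
    unfolding Z_def dotc_add dotc_scale dotc_sum ..
  have Z_tight: "dotc d A (Z \<sigma>) j = real_of_int (v j)" if "\<sigma> \<in> \<Delta>" "j \<in> \<sigma>" for \<sigma> j
  proof -
    have "(\<Sum>i\<in>\<sigma>. (real_of_int (v i) - real N * w i) * dotc d A (dual \<sigma> i) j)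
        = (\<Sum>i\<in>\<sigma>. if i = j then real_of_int (v i) - real N * w i else 0)"
      using dual_basis[OF that(1) _ that(2)] by (intro sum.cong) auto
    also have "\<dots> = real_of_int (v j) - real N * w j"
      using finite_face[OF that(1)] that(2) by simp
    finally show ?thesis using Y_tight[OF that] by (simp add: Z)
  qed
  have Z_gap: "real_of_int (v k) - dotc d A (Z \<sigma>) k
      \<ge> real N * (w k - dotc d A (Y \<sigma>) k) - t \<sigma> k" for \<sigma> k
  proof -
    have "(\<Sum>i\<in>\<sigma>. (real_of_int (v i) - real N * w i) * dotc d A (dual \<sigma> i) k)
        \<le> (\<Sum>i\<in>\<sigma>. \<bar>dotc d A (dual \<sigma> i) k\<bar>)"
    proof (rule sum_mono)
      fix i
      have "\<bar>real_of_int (v i) - real N * w i\<bar> \<le> 1" unfolding v_def by linarith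
      then have "\<bar>(real_of_int (v i) - real N * w i) * dotc d A (dual \<sigma> i) k\<bar>
          \<le> 1 * \<bar>dotc d A (dual \<sigma> i) k\<bar>"
        unfolding abs_mult by (rule mult_right_mono) simp
      then show "(real_of_int (v i) - real N * w i) * dotc d A (dual \<sigma> i) k
          \<le> \<bar>dotc d A (dual \<sigma> i) k\<bar>" by simp
    qed
    moreover have "real_of_int (v k) \<ge> real N * w k - 1" unfolding v_def by linarith
    ultimately show ?thesis by (simp add: Z t_def algebra_simps)
  qed
  show ?thesis
  proof (rule that)
    show "K ^ j \<le> f j" "f j \<le> K ^ j + 1" for j
      unfolding f_def by linarith+
    show "dotc d A (Z \<sigma>) j = real_of_int (c j)" if "\<sigma> \<in> \<Delta>" "j \<in> \<sigma>" for \<sigma> j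
      using Z_tight[OF that] that by (auto simp: c_def)
  next
    fix \<sigma> j
    assume j: "\<sigma> \<in> \<Delta>" "j < n" "j \<notin> \<sigma>" "colv d A j \<in> cone_of d A \<sigma>"
    \<comment> \<open>A vertex has coordinate 1 at itself, but coordinates off
      \<open>\<sigma>\<close> vanish for columns in its cone.\<close>
    have "j \<notin> \<Union>\<Delta>"
      using coord_vertex[of j j] coord_in_cone[OF j(2,1,4,3)] by auto
    then have "real_of_int (c j) = S j + M * height j + f j" by (simp add: c_def f_def)
    moreover have "dotc d A (Z \<sigma>) j = S j"
      unfolding coord_expansion[OF j(2)] S_def
    proof (rule sum.cong)
      fix k
      show "dotc d A (Z \<sigma>) k * coord j k = real_of_int (v k) * coord j k"
        using Z_tight[OF j(1), of k] coord_in_cone[OF j(2,1,4), of k] by (cases "k \<in> \<sigma>") auto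
    qed simp
    ultimately show "real_of_int (c j) - dotc d A (Z \<sigma>) j = M * height j + f j" by simp
  next
    fix \<sigma> j
    assume j: "\<sigma> \<in> \<Delta>" "j < n" "colv d A j \<notin> cone_of d A \<sigma>"
    obtain k where k: "k < n" "k \<notin> \<sigma>" "coord j k \<noteq> 0"
      using in_cone_if_coord[OF j(2,1)] j(3) by blast
    \<comment> \<open>One nonzero coordinate off \<open>\<sigma>\<close> already contributes more
      than \<open>r\<close>; all other terms are nonnegative.\<close>
    have term_gt: "r < (real_of_int (v m) - dotc d A (Z \<sigma>) m) * coord j m"
      if "m < n" "m \<notin> \<sigma>" "coord j m \<noteq> 0" for m
    proof -
      have pos: "coord j m > 0" using coord_nonneg[OF j(2), of m] that(3) by simp
      have "r < coord j m * (real N * (w m - dotc d A (Y \<sigma>) m) - t \<sigma> m)"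
        by (rule N[OF j(1,2) that(1) pos that(2)])
      also have "\<dots> \<le> coord j m * (real_of_int (v m) - dotc d A (Z \<sigma>) m)"
        using Z_gap[of m \<sigma>] pos by (intro mult_left_mono) auto
      finally show ?thesis by (simp add: mult.commute)
    qed
    have nonneg: "0 \<le> (real_of_int (v m) - dotc d A (Z \<sigma>) m) * coord j m" if "m < n" for m
      using term_gt[OF that] Z_tight[OF j(1), of m] assms(3)
      by (cases "m \<in> \<sigma>"; cases "coord j m = 0") auto
    have "r < (\<Sum>m<n. (real_of_int (v m) - dotc d A (Z \<sigma>) m) * coord j m)"
      using term_gt[OF k] nonneg k(1)
      by (intro less_le_trans[OF _ member_le_sum[of k]]) auto
    also have "\<dots> = S j - dotc d A (Z \<sigma>) j"
      by (simp add: coord_expansion[OF j(2)] S_def sum_subtractf algebra_simps)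
    finally have "r < S j - dotc d A (Z \<sigma>) j" .
    \<comment> \<open>The cost equals the piecewise linear extension at vertices and is raised
      elsewhere.\<close>
    moreover have "S j \<le> real_of_int (c j)"
    proof (cases "j \<in> \<Union>\<Delta>")
      case True
      have "S j = (\<Sum>m<n. if m = j then real_of_int (v m) else 0)"
        unfolding S_def by (intro sum.cong) (auto simp: coord_vertex[OF True])
      then show ?thesis using True j(2) by (simp add: c_def)
    next
      case False
      have "0 \<le> M * height j + K ^ j"
        using assms(1,2) height_pos[OF j(2)] by (simp add: less_imp_le)
      then show ?thesis using False unfolding c_def by simp linarith
    qed
    ultimately show "real_of_int (c j) - dotc d A (Z \<sigma>) j > r" by linarith
  qed
qed

end

section \<open>Group relaxations and optimality\<close>

text \<open>Weight scales: one unit of height (M) outweighs every possible tie-break term,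
  and leaving the cone of a face outweighs every possible height. B bounds the non-vertex
  coordinates of cheap solutions, so a tie-break f superincreasing for B separates them.\<close>

locale gomory_cost =
  supported_triangulation d n A \<Delta> "\<lambda>j. real_of_int (c j)" Y
  for d n :: nat and A :: "nat \<Rightarrow> nat \<Rightarrow> int" and \<Delta> :: "nat set set"
    and c :: "nat \<Rightarrow> int" and Y :: "nat set \<Rightarrow> nat \<Rightarrow> real" +
  fixes M B :: real and f :: "nat \<Rightarrow> real"
  assumes normal: "Delta_normal d n A \<Delta>"
    and cost_in: "\<And>\<sigma> j. \<sigma> \<in> \<Delta> \<Longrightarrow> j < n \<Longrightarrow> j \<notin> \<sigma> \<Longrightarrow> colv d A j \<in> cone_of d A \<sigma>
       \<Longrightarrow> real_of_int (c j) - dotc d A (Y \<sigma>) j = M * height j + f j"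
    and cost_out: "\<And>\<sigma> j. \<sigma> \<in> \<Delta> \<Longrightarrow> j < n \<Longrightarrow> colv d A j \<notin> cone_of d A \<sigma>
       \<Longrightarrow> real_of_int (c j) - dotc d A (Y \<sigma>) j > M * real n + B * (\<Sum>j<n. f j)"
    and M_gt: "M > B * (\<Sum>j<n. f j)"
    and B_nonneg: "B \<ge> 0"
    and B_height: "\<And>j. j < n \<Longrightarrow> real n \<le> B * height j"
    and f_pos: "\<And>j. f j > 0"
    and f_super: "\<And>j. f j > B * (\<Sum>i<j. f i)"
begin

lemma M_pos: "M > 0"
proof -
  have "0 \<le> B * (\<Sum>j<n. f j)"
    using B_nonneg f_pos by (intro mult_nonneg_nonneg sum_nonneg) (auto simp: less_imp_le)
  then show ?thesis using M_gt by linarith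
qed

text \<open>Written with the support vector, so that it makes sense on every face; on maximal faces,
  under full rank, it is the group objective.\<close>

definition rcost :: "nat set \<Rightarrow> (nat \<Rightarrow> int) \<Rightarrow> real" where
  "rcost \<sigma> x = (\<Sum>j\<in>{..<n} - \<sigma>. (real_of_int (c j) - dotc d A (Y \<sigma>) j) * real_of_int (x j))"

lemma sum_split_face:
  fixes g :: "nat \<Rightarrow> real"
  assumes "\<sigma> \<in> \<Delta>"
  shows "(\<Sum>j<n. g j) = (\<Sum>j\<in>\<sigma>. g j) + (\<Sum>j\<in>{..<n} - \<sigma>. g j)"
  using sum.subset_diff[OF face_subset[OF assms], of g] by simp

text \<open>Cost and \<open>rcost\<close> differ by a term depending only on \<open>b\<close> and
  the face, so they have the same minimisers.\<close>

lemma cost_decomposition: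
  assumes "\<sigma> \<in> \<Delta>" "\<forall>i<d. (\<Sum>j<n. A i j * x j) = b i"
  shows "(\<Sum>j<n. real_of_int (c j) * real_of_int (x j))
      = (\<Sum>i<d. Y \<sigma> i * real_of_int (b i)) + rcost \<sigma> x"
proof -
  have "\<forall>i<d. real_of_int (b i) = (\<Sum>j<n. real_of_int (A i j) * real_of_int (x j))"
    by (simp flip: assms(2)[rule_format])
  then have "(\<Sum>i<d. Y \<sigma> i * real_of_int (b i)) = (\<Sum>j<n. dotc d A (Y \<sigma>) j * real_of_int (x j))"
    by (rule dotc_combination)
  then have "(\<Sum>j<n. real_of_int (c j) * real_of_int (x j)) - (\<Sum>i<d. Y \<sigma> i * real_of_int (b i))
      = (\<Sum>j<n. (real_of_int (c j) - dotc d A (Y \<sigma>) j) * real_of_int (x j))"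
    by (simp add: sum_subtractf algebra_simps)
  also have "\<dots> = rcost \<sigma> x"
    unfolding rcost_def sum_split_face[OF assms(1)] using Y_tight[OF assms(1)] by simp
  finally show ?thesis by simp
qed

text \<open>Pair both sides with the dual basis vector at \<open>i\<close>: among the members of the
  face only \<open>i\<close> contributes, and a column off the face contributes its
  coordinate.\<close>

lemma face_coefficients:
  assumes \<sigma>: "\<sigma> \<in> \<Delta>"
    and b: "\<forall>i<d. (\<Sum>k\<in>\<sigma>. real_of_int (A i k) * \<beta> k) = (\<Sum>j<n. real_of_int (A i j) * x j)"
    and supp: "\<And>j. j < n \<Longrightarrow> colv d A j \<notin> cone_of d A \<sigma> \<Longrightarrow> x j = 0"
    and i: "i \<in> \<sigma>"
  shows "\<beta> i = x i + (\<Sum>j\<in>{..<n} - \<sigma>. coord j i * x j)"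
proof -
  define v where "v m = (\<Sum>k\<in>\<sigma>. real_of_int (A m k) * \<beta> k)" for m
  have "\<beta> i = (\<Sum>m<d. dual \<sigma> i m * v m)"
    by (rule dual_coeff[OF \<sigma> i, symmetric]) (simp add: v_def)
  also have "\<dots> = (\<Sum>j<n. dotc d A (dual \<sigma> i) j * x j)"
    by (rule dotc_combination) (use b in \<open>simp add: v_def\<close>)
  also have "\<dots> = (\<Sum>j<n. coord j i * x j)"
  proof (rule sum.cong)
    fix j assume "j \<in> {..<n}"
    then show "dotc d A (dual \<sigma> i) j * x j = coord j i * x j"
      using supp[of j] dual_column[OF _ \<sigma> _ i, of j]
      by (cases "colv d A j \<in> cone_of d A \<sigma>") auto
  qed simp
  also have "\<dots> = (\<Sum>j\<in>\<sigma>. coord j i * x j) + (\<Sum>j\<in>{..<n} - \<sigma>. coord j i * x j)"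
    by (rule sum_split_face[OF \<sigma>])
  also have "(\<Sum>j\<in>\<sigma>. coord j i * x j) = (\<Sum>j\<in>\<sigma>. if j = i then x j else 0)"
  proof (rule sum.cong)
    fix j assume "j \<in> \<sigma>"
    then have "j \<in> \<Union>\<Delta>" using \<sigma> by blast
    then show "coord j i * x j = (if j = i then x j else 0)"
      by (simp add: coord_vertex)
  qed simp
  also have "\<dots> = x i" using finite_face[OF \<sigma>] i by simp
  finally show ?thesis .
qed

lemma face_height:
  assumes \<sigma>: "\<sigma> \<in> \<Delta>"
    and b: "\<forall>i<d. (\<Sum>k\<in>\<sigma>. real_of_int (A i k) * \<beta> k) = (\<Sum>j<n. real_of_int (A i j) * x j)"
    and supp: "\<And>j. j < n \<Longrightarrow> colv d A j \<notin> cone_of d A \<sigma> \<Longrightarrow> x j = 0"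
  shows "(\<Sum>j\<in>{..<n} - \<sigma>. height j * x j) = (\<Sum>i\<in>\<sigma>. \<beta> i - x i)"
proof -
  have "(\<Sum>i\<in>\<sigma>. \<beta> i - x i) = (\<Sum>i\<in>\<sigma>. \<Sum>j\<in>{..<n} - \<sigma>. coord j i * x j)"
    using face_coefficients[OF assms] by (intro sum.cong) auto
  also have "\<dots> = (\<Sum>j\<in>{..<n} - \<sigma>. \<Sum>i\<in>\<sigma>. coord j i * x j)"
    by (rule sum.swap)
  also have "\<dots> = (\<Sum>j\<in>{..<n} - \<sigma>. height j * x j)"
  proof (rule sum.cong)
    fix j assume j: "j \<in> {..<n} - \<sigma>"
    show "(\<Sum>i\<in>\<sigma>. coord j i * x j) = height j * x j"
    proof (cases "colv d A j \<in> cone_of d A \<sigma>")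
      case True
      have "height j = (\<Sum>i\<in>\<sigma>. coord j i)"
        unfolding height_def using coord_in_cone[OF _ \<sigma> True] j face_subset[OF \<sigma>]
        by (intro sum.mono_neutral_right) auto
      then show ?thesis by (simp add: sum_distrib_right)
    qed (use supp[of j] j in simp)
  qed simp
  finally show ?thesis by simp
qed

text \<open>The heights used off the face add up to what \<open>x\<close> lacks on the face, so
  \<open>M\<close> charges exactly this deficit.\<close>

lemma rcost_supported:
  assumes \<sigma>: "\<sigma> \<in> \<Delta>"
    and b: "\<forall>i<d. (\<Sum>k\<in>\<sigma>. real_of_int (A i k) * \<beta> k)
      = (\<Sum>j<n. real_of_int (A i j) * real_of_int (x j))"
    and supp: "\<And>j. j < n \<Longrightarrow> colv d A j \<notin> cone_of d A \<sigma> \<Longrightarrow> x j = 0"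
  shows "rcost \<sigma> x = M * (\<Sum>i\<in>\<sigma>. \<beta> i - real_of_int (x i))
      + (\<Sum>j\<in>{..<n} - \<sigma>. f j * real_of_int (x j))"
proof -
  have "rcost \<sigma> x = (\<Sum>j\<in>{..<n} - \<sigma>. M * (height j * real_of_int (x j)) + f j * real_of_int (x j))"
    unfolding rcost_def
  proof (rule sum.cong)
    fix j assume j: "j \<in> {..<n} - \<sigma>"
    show "(real_of_int (c j) - dotc d A (Y \<sigma>) j) * real_of_int (x j)
        = M * (height j * real_of_int (x j)) + f j * real_of_int (x j)"
      using cost_in[OF \<sigma>, of j] supp[of j] j
      by (cases "colv d A j \<in> cone_of d A \<sigma>") (auto simp: algebra_simps)
  qed simp
  also have "\<dots> = M * (\<Sum>j\<in>{..<n} - \<sigma>. height j * real_of_int (x j))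
      + (\<Sum>j\<in>{..<n} - \<sigma>. f j * real_of_int (x j))"
    by (simp add: sum.distrib sum_distrib_left)
  also have "(\<Sum>j\<in>{..<n} - \<sigma>. height j * real_of_int (x j)) = (\<Sum>i\<in>\<sigma>. \<beta> i - real_of_int (x i))"
    by (rule face_height[OF \<sigma> b]) (simp add: supp)
  finally show ?thesis .
qed

lemma small_height_bound:
  assumes \<sigma>: "\<sigma> \<in> \<Delta>"
    and le: "(\<Sum>j\<in>{..<n} - \<sigma>. height j * real_of_int (x j)) \<le> real n"
    and nonneg: "\<And>j. j \<in> {..<n} - \<sigma> \<Longrightarrow> x j \<ge> 0"
    and j: "j \<in> {..<n} - \<sigma>"
  shows "real_of_int (x j) \<le> B"
proof -
  have "height j * real_of_int (x j) \<le> (\<Sum>j\<in>{..<n} - \<sigma>. height j * real_of_int (x j))"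
    using nonneg height_pos j by (intro member_le_sum) (auto simp: less_imp_le)
  also have "\<dots> \<le> height j * B" using le B_height[of j] j by (simp add: mult.commute)
  finally show ?thesis using height_pos[of j] j by simp
qed

lemma sum_fractions_le:
  assumes "\<sigma> \<in> \<Delta>"
  shows "(\<Sum>i\<in>\<sigma>. \<beta> i - real_of_int \<lfloor>\<beta> i :: real\<rfloor>) \<le> real n"
proof -
  have "(\<Sum>i\<in>\<sigma>. \<beta> i - real_of_int \<lfloor>\<beta> i\<rfloor>) \<le> real (card \<sigma>) * 1"
    by (rule sum_bounded_above) linarith
  also have "\<dots> \<le> real n"
    using card_mono[OF _ face_subset[OF assms]] by simp
  finally show ?thesis .
qed

text \<open>Apart from multiples of the generators of the face, the Hilbert basis is used only
  for the fractional part of the right-hand side.\<close>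

lemma hilbert_representation:
  assumes max: "maximal_face \<Delta> \<sigma>"
    and \<beta>: "\<forall>k. \<beta> k \<ge> (0::real)"
      "\<forall>i<d. real_of_int (b i) = (\<Sum>k\<in>\<sigma>. real_of_int (A i k) * \<beta> k)"
  obtains x where "group_feasible d n A \<sigma> b x" "\<And>j. x j \<ge> 0"
    "\<And>j. j < n \<Longrightarrow> colv d A j \<notin> cone_of d A \<sigma> \<Longrightarrow> x j = 0"
    "\<And>i. i \<in> \<sigma> \<Longrightarrow> \<lfloor>\<beta> i\<rfloor> \<le> x i"
proof -
  have \<sigma>: "\<sigma> \<in> \<Delta>" using max by (simp add: maximal_face_def)
  let ?C = "{j. j < n \<and> colv d A j \<in> cone_of d A \<sigma>}"
  \<comment> \<open>The fractional part of \<open>b\<close>: an integer point in the half-open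
    parallelepiped of the face.\<close>
  define p where "p i = (if i < d then b i - (\<Sum>k\<in>\<sigma>. A i k * \<lfloor>\<beta> k\<rfloor>) else 0)" for i
  have "(\<lambda>i. real_of_int (p i)) \<in> cone_of d A \<sigma>"
    unfolding cone_of_def
  proof (intro CollectI conjI exI[of _ "\<lambda>k. \<beta> k - real_of_int \<lfloor>\<beta> k\<rfloor>"] allI impI ballI)
    fix i assume "i < d"
    then show "real_of_int (p i) = (\<Sum>k\<in>\<sigma>. real_of_int (A i k) * (\<beta> k - real_of_int \<lfloor>\<beta> k\<rfloor>))"
      using \<beta>(2) by (simp add: p_def right_diff_distrib sum_subtractf)
  qed (simp_all add: p_def)
  moreover have "(\<lambda>i. real_of_int (p i)) \<in> int_points d"
    by (simp add: int_points_def p_def)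
  ultimately have "(\<lambda>i. real_of_int (p i)) \<in> cone_of d A \<sigma> \<inter> int_points d" ..
  from normal[unfolded Delta_normal_def, rule_format, OF max this] obtain u :: "nat \<Rightarrow> nat" where
    u: "\<forall>i<d. real_of_int (p i) = (\<Sum>j\<in>?C. real_of_int (A i j) * real (u j))"
    by blast
  \<comment> \<open>The Hilbert basis may use columns of \<open>\<sigma>\<close> too, so there its
    multiplicity is added to the integer part.\<close>
  define x where "x j = (if j \<in> ?C then int (u j) else 0) + (if j \<in> \<sigma> then \<lfloor>\<beta> j\<rfloor> else 0)" for j
  have \<sigma>C: "\<sigma> \<subseteq> ?C"
    using colv_in_cone_of_member[OF _ finite_face[OF \<sigma>]] face_less[OF \<sigma>] by blast
  show ?thesis
  proof (rule that)
    show x_nonneg: "x j \<ge> 0" for j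
      using \<beta>(1) by (simp add: x_def)
    show "x j = 0" if "j < n" "colv d A j \<notin> cone_of d A \<sigma>" for j
      using that \<sigma>C by (auto simp: x_def)
    show "\<lfloor>\<beta> i\<rfloor> \<le> x i" if "i \<in> \<sigma>" for i
      using that by (simp add: x_def)
    show "group_feasible d n A \<sigma> b x"
      unfolding group_feasible_def
    proof (intro conjI allI impI ballI)
      fix j assume "n \<le> j"
      then show "x j = 0" using face_subset[OF \<sigma>] by (auto simp: x_def)
    next
      fix i assume i: "i < d"
      have "(\<Sum>j<n. A i j * x j) = (\<Sum>j<n. if j \<in> ?C then A i j * int (u j) else 0)
          + (\<Sum>j<n. if j \<in> \<sigma> then A i j * \<lfloor>\<beta> j\<rfloor> else 0)"
        unfolding sum.distrib[symmetric] by (intro sum.cong) (auto simp: x_def algebra_simps)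
      also have "(\<Sum>j<n. if j \<in> ?C then A i j * int (u j) else 0) = (\<Sum>j\<in>?C. A i j * int (u j))"
        by (intro sum.mono_neutral_cong_right) auto
      also have "(\<Sum>j<n. if j \<in> \<sigma> then A i j * \<lfloor>\<beta> j\<rfloor> else 0) = (\<Sum>j\<in>\<sigma>. A i j * \<lfloor>\<beta> j\<rfloor>)"
        using face_subset[OF \<sigma>] by (intro sum.mono_neutral_cong_right) auto
      also have "(\<Sum>j\<in>?C. A i j * int (u j)) = p i"
      proof -
        have "real_of_int (\<Sum>j\<in>?C. A i j * int (u j)) = real_of_int (p i)"
          using u i by simp
        then show ?thesis by linarith
      qed
      finally show "(\<Sum>j<n. A i j * x j) = b i" using i by (simp add: p_def)
    qed (rule x_nonneg)
  qed
qed

text \<open>\<open>x0\<close> comes from the Hilbert basis and serves as a cost threshold. Anything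
  at most as expensive stays in the cone and has the integer parts of \<open>b\<close> on the face,
  so such solutions differ in cost only by the tie-break.\<close>

lemma cheap_group_solutions:
  assumes max: "maximal_face \<Delta> \<sigma>"
    and cone: "(\<lambda>i. real_of_int (b i)) \<in> cone_of d A \<sigma>"
  obtains x0 :: "nat \<Rightarrow> int" and \<beta> :: "nat \<Rightarrow> int" and C :: real where
    "group_feasible d n A \<sigma> b x0" "\<And>j. x0 j \<ge> 0" "\<And>j. \<beta> j \<ge> 0"
    "\<And>x j. group_feasible d n A \<sigma> b x \<Longrightarrow> rcost \<sigma> x \<le> rcost \<sigma> x0 \<Longrightarrow> j \<in> \<sigma> \<Longrightarrow> x j = \<beta> j"
    "\<And>x j. group_feasible d n A \<sigma> b x \<Longrightarrow> rcost \<sigma> x \<le> rcost \<sigma> x0 \<Longrightarrow> j \<in> {..<n} - \<sigma>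
      \<Longrightarrow> real_of_int (x j) \<le> B"
    "\<And>x. group_feasible d n A \<sigma> b x \<Longrightarrow> rcost \<sigma> x \<le> rcost \<sigma> x0
      \<Longrightarrow> rcost \<sigma> x = C + (\<Sum>j\<in>{..<n} - \<sigma>. f j * real_of_int (x j))"
proof -
  have \<sigma>: "\<sigma> \<in> \<Delta>" using max by (simp add: maximal_face_def)
  from cone obtain \<beta> where \<beta>: "\<forall>k. \<beta> k \<ge> (0::real)"
    "\<forall>i<d. real_of_int (b i) = (\<Sum>k\<in>\<sigma>. real_of_int (A i k) * \<beta> k)"
    by (rule cone_of_coeffs)
  from max \<beta> obtain x0 where x0: "group_feasible d n A \<sigma> b x0" "\<And>j. x0 j \<ge> 0"
    "\<And>j. j < n \<Longrightarrow> colv d A j \<notin> cone_of d A \<sigma> \<Longrightarrow> x0 j = 0"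
    "\<And>i. i \<in> \<sigma> \<Longrightarrow> \<lfloor>\<beta> i\<rfloor> \<le> x0 i"
    by (rule hilbert_representation) blast
  define C where "C = (\<Sum>i\<in>\<sigma>. \<beta> i - real_of_int \<lfloor>\<beta> i\<rfloor>)"
  define F where "F = B * (\<Sum>j<n. f j)"
  have C_le: "C \<le> real n" unfolding C_def by (rule sum_fractions_le[OF \<sigma>])
  have feasible_eq: "\<forall>i<d. (\<Sum>k\<in>\<sigma>. real_of_int (A i k) * \<beta> k)
      = (\<Sum>j<n. real_of_int (A i j) * real_of_int (x j))" if "group_feasible d n A \<sigma> b x" for x
  proof (intro allI impI)
    fix i assume i: "i < d"
    then have "real_of_int (b i) = real_of_int (\<Sum>j<n. A i j * x j)"
      using that by (simp add: group_feasible_def)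
    then show "(\<Sum>k\<in>\<sigma>. real_of_int (A i k) * \<beta> k)
        = (\<Sum>j<n. real_of_int (A i j) * real_of_int (x j))"
      using \<beta>(2) i by simp
  qed
  have x0_frac: "(\<Sum>i\<in>\<sigma>. \<beta> i - real_of_int (x0 i)) \<le> C"
    unfolding C_def using x0(4) by (intro sum_mono) simp
  have x0_height: "(\<Sum>j\<in>{..<n} - \<sigma>. height j * real_of_int (x0 j)) \<le> real n"
    using face_height[OF \<sigma> feasible_eq[OF x0(1)]] x0(3) x0_frac C_le by simp
  have "(\<Sum>j\<in>{..<n} - \<sigma>. f j * real_of_int (x0 j)) \<le> (\<Sum>j\<in>{..<n} - \<sigma>. f j * B)"
    using small_height_bound[OF \<sigma> x0_height x0(2)] f_pos
    by (intro sum_mono mult_left_mono) (auto simp: less_imp_le)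
  also have "\<dots> \<le> (\<Sum>j<n. f j * B)"
    using f_pos B_nonneg by (intro sum_mono2) (auto simp: less_imp_le)
  also have "\<dots> = F" by (simp add: F_def sum_distrib_left mult.commute)
  finally have x0_tie: "(\<Sum>j\<in>{..<n} - \<sigma>. f j * real_of_int (x0 j)) \<le> F" .
  have "M * (\<Sum>i\<in>\<sigma>. \<beta> i - real_of_int (x0 i)) \<le> M * C"
    using x0_frac M_pos by (intro mult_left_mono) auto
  then have x0_cost: "rcost \<sigma> x0 \<le> M * C + F"
    using rcost_supported[OF \<sigma> feasible_eq[OF x0(1)] x0(3)] x0_tie by linarith
  have main: "(\<forall>j\<in>\<sigma>. x j = \<lfloor>\<beta> j\<rfloor>) \<and> (\<forall>j\<in>{..<n} - \<sigma>. real_of_int (x j) \<le> B) \<and>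
      rcost \<sigma> x = M * C + (\<Sum>j\<in>{..<n} - \<sigma>. f j * real_of_int (x j))"
    if x: "group_feasible d n A \<sigma> b x" "rcost \<sigma> x \<le> rcost \<sigma> x0" for x
  proof -
    have nonneg: "x j \<ge> 0" if "j \<in> {..<n} - \<sigma>" for j
      using x(1) that by (simp add: group_feasible_def)
    have supp: "x j = 0" if j: "j < n" "colv d A j \<notin> cone_of d A \<sigma>" for j
    proof (rule ccontr)
      assume "x j \<noteq> 0"
      have j\<sigma>: "j \<in> {..<n} - \<sigma>"
        using j colv_in_cone_of_member[OF _ finite_face[OF \<sigma>]] by auto
      have 1: "real_of_int (x j) \<ge> 1" using nonneg[OF j\<sigma>] \<open>x j \<noteq> 0\<close> by simp
      have gap: "0 \<le> real_of_int (c k) - dotc d A (Y \<sigma>) k" if "k \<in> {..<n} - \<sigma>" for k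
        using Y_strict[OF \<sigma>, of k] that by simp
      \<comment> \<open>A single unit of a column outside the cone exceeds the cost bound for
        \<open>x0\<close>.\<close>
      have "M * C + F \<le> M * real n + F" using C_le M_pos by simp
      also have "\<dots> < (real_of_int (c j) - dotc d A (Y \<sigma>) j) * 1"
        using cost_out[OF \<sigma> j] by (simp add: F_def)
      also have "\<dots> \<le> (real_of_int (c j) - dotc d A (Y \<sigma>) j) * real_of_int (x j)"
        using 1 gap[OF j\<sigma>] by (rule mult_left_mono)
      also have "\<dots> \<le> rcost \<sigma> x"
        unfolding rcost_def using j\<sigma> gap nonneg by (intro member_le_sum) auto
      finally show False using x(2) x0_cost by simp
    qed
    note eq = feasible_eq[OF x(1)]
    have cost: "rcost \<sigma> x = M * (\<Sum>i\<in>\<sigma>. \<beta> i - real_of_int (x i))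
      + (\<Sum>j\<in>{..<n} - \<sigma>. f j * real_of_int (x j))"
      by (rule rcost_supported[OF \<sigma> eq supp])
    \<comment> \<open>The columns off the face only add nonnegative amounts to coordinate
      \<open>i\<close>.\<close>
    have floor: "x i \<le> \<lfloor>\<beta> i\<rfloor>" if i: "i \<in> \<sigma>" for i
    proof -
      have "\<beta> i = real_of_int (x i) + (\<Sum>j\<in>{..<n} - \<sigma>. coord j i * real_of_int (x j))"
        by (rule face_coefficients[OF \<sigma> eq _ i]) (simp add: supp)
      moreover have "(\<Sum>j\<in>{..<n} - \<sigma>. coord j i * real_of_int (x j)) \<ge> 0"
        using nonneg coord_nonneg by (intro sum_nonneg mult_nonneg_nonneg) auto
      ultimately show ?thesis by (simp add: le_floor_iff)
    qed
    have tie: "(\<Sum>j\<in>{..<n} - \<sigma>. f j * real_of_int (x j)) \<ge> 0"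
      using nonneg f_pos by (intro sum_nonneg mult_nonneg_nonneg) (auto simp: less_imp_le)
    \<comment> \<open>One missing unit on the face raises the height term by \<open>M\<close>, more
      than the whole tie-break allowance \<open>F\<close> of \<open>x0\<close>.\<close>
    have eq_floor: "x i = \<lfloor>\<beta> i\<rfloor>" if i: "i \<in> \<sigma>" for i
    proof (rule ccontr)
      assume "x i \<noteq> \<lfloor>\<beta> i\<rfloor>"
      then have 1: "1 \<le> real_of_int (\<lfloor>\<beta> i\<rfloor> - x i)" using floor[OF i] by linarith
      also have "\<dots> \<le> (\<Sum>k\<in>\<sigma>. real_of_int (\<lfloor>\<beta> k\<rfloor> - x k))"
        using floor i finite_face[OF \<sigma>]
        by (intro member_le_sum[of i \<sigma> "\<lambda>k. real_of_int (\<lfloor>\<beta> k\<rfloor> - x k)"]) auto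
      also have "\<dots> = (\<Sum>i\<in>\<sigma>. \<beta> i - real_of_int (x i)) - C"
        by (simp add: C_def sum_subtractf)
      finally have "M * (C + 1) \<le> M * (\<Sum>i\<in>\<sigma>. \<beta> i - real_of_int (x i))"
        using M_pos by simp
      then have "M * C + M \<le> rcost \<sigma> x" using cost tie by (simp add: distrib_left)
      then show False using x(2) x0_cost M_gt by (simp add: F_def)
    qed
    have frac: "(\<Sum>i\<in>\<sigma>. \<beta> i - real_of_int (x i)) = C"
      unfolding C_def using eq_floor by simp
    have height: "(\<Sum>j\<in>{..<n} - \<sigma>. height j * real_of_int (x j)) \<le> real n"
      using face_height[OF \<sigma> eq] supp frac C_le by simp
    have "real_of_int (x j) \<le> B" if "j \<in> {..<n} - \<sigma>" for j
      by (rule small_height_bound[OF \<sigma> height nonneg that])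
    then show ?thesis
      using eq_floor cost unfolding frac by blast
  qed
  show ?thesis
  proof (rule that[of x0 "\<lambda>j. \<lfloor>\<beta> j\<rfloor>" "M * C"])
    show "\<lfloor>\<beta> j\<rfloor> \<ge> 0" for j using \<beta>(1) by simp
  qed (use x0(1,2) main in blast)+
qed

section \<open>Transfer between group relaxations and integer programs\<close>

lemma rcost_nonneg:
  assumes "\<sigma> \<in> \<Delta>" "\<And>j. j \<in> {..<n} - \<sigma> \<Longrightarrow> x j \<ge> 0"
  shows "rcost \<sigma> x \<ge> 0"
  unfolding rcost_def
proof (intro sum_nonneg mult_nonneg_nonneg)
  fix j assume "j \<in> {..<n} - \<sigma>"
  then show "0 \<le> real_of_int (c j) - dotc d A (Y \<sigma>) j" "0 \<le> real_of_int (x j)"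
    using Y_strict[OF assms(1), of j] assms(2) by auto
qed

lemma group_feasible_of_ip:
  "ip_feasible d n A b x \<Longrightarrow> group_feasible d n A \<sigma> b (\<lambda>j. int (x j))"
  by (simp add: ip_feasible_def group_feasible_def)

lemma ip_feasible_of_group:
  assumes "group_feasible d n A \<sigma> b x" "\<And>j. x j \<ge> 0"
  shows "ip_feasible d n A b (\<lambda>j. nat (x j))"
  using assms by (simp add: ip_feasible_def group_feasible_def)

lemma ip_cost:
  assumes "\<sigma> \<in> \<Delta>" "ip_feasible d n A b x"
  shows "(\<Sum>j<n. real_of_int (c j) * real (x j))
      = (\<Sum>i<d. Y \<sigma> i * real_of_int (b i)) + rcost \<sigma> (\<lambda>j. int (x j))"
  using cost_decomposition[OF assms(1), of "\<lambda>j. int (x j)" b] assms(2)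
  by (simp add: ip_feasible_def)

lemma ip_optimal_iff:
  assumes "\<sigma> \<in> \<Delta>"
  shows "ip_optimal d n A (\<lambda>j. real_of_int (c j)) b x \<longleftrightarrow> ip_feasible d n A b x \<and>
    (\<forall>x'. ip_feasible d n A b x' \<longrightarrow> rcost \<sigma> (\<lambda>j. int (x j)) \<le> rcost \<sigma> (\<lambda>j. int (x' j)))"
  unfolding ip_optimal_def using ip_cost[OF assms] by auto

text \<open>Weak duality bounds the cost below by the value of the support vector at
  \<open>b\<close>. As the costs are integers, subtracting \<open>l\<close> reduces to a minimum
  over natural numbers.\<close>

lemma ip_optimal_exists:
  assumes \<sigma>: "\<sigma> \<in> \<Delta>" and feasible: "ip_feasible d n A b x0"
  shows "\<exists>x. ip_optimal d n A (\<lambda>j. real_of_int (c j)) b x"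
proof -
  define l where "l = \<lfloor>\<Sum>i<d. Y \<sigma> i * real_of_int (b i)\<rfloor>"
  define g where "g x = (\<Sum>j<n. c j * int (x j))" for x :: "nat \<Rightarrow> nat"
  have lower: "l \<le> g x" if "ip_feasible d n A b x" for x
  proof -
    have "rcost \<sigma> (\<lambda>j. int (x j)) \<ge> 0" by (rule rcost_nonneg[OF \<sigma>]) simp
    then have "(\<Sum>i<d. Y \<sigma> i * real_of_int (b i)) \<le> real_of_int (g x)"
      using ip_cost[OF \<sigma> that] by (simp add: g_def)
    then show ?thesis unfolding l_def by linarith
  qed
  obtain x where x: "ip_feasible d n A b x"
    "\<And>x'. ip_feasible d n A b x' \<Longrightarrow> nat (g x - l) \<le> nat (g x' - l)"
    using ex_has_least_nat[of "ip_feasible d n A b" x0 "\<lambda>x. nat (g x - l)"] feasible by blast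
  have "g x \<le> g x'" if "ip_feasible d n A b x'" for x'
    using x(2)[OF that] lower[OF that] lower[OF x(1)] by linarith
  then have "(\<Sum>j<n. real_of_int (c j) * real (x j)) \<le> (\<Sum>j<n. real_of_int (c j) * real (x' j))"
    if "ip_feasible d n A b x'" for x'
    using that of_int_le_iff[of "g x" "g x'", where 'a = real] by (simp add: g_def)
  then show ?thesis using x(1) unfolding ip_optimal_def by blast
qed

lemma NA_face:
  assumes "b \<in> NA d n A"
  obtains \<sigma> where "maximal_face \<Delta> \<sigma>" "(\<lambda>i. real_of_int (b i)) \<in> cone_of d A \<sigma>"
proof -
  from assms obtain u where u: "\<forall>i\<ge>d. b i = 0" "\<forall>i<d. b i = (\<Sum>j<n. A i j * int (u j))"
    by (auto simp: NA_def)
  then have "(\<lambda>i. real_of_int (b i)) \<in> cone_of d A {..<n}"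
    unfolding cone_of_def by (auto intro!: exI[of _ "\<lambda>j. real (u j)"])
  then show ?thesis using maximal_cover that by blast
qed

text \<open>Optimal solutions are at most as expensive as \<open>x0\<close>, hence agree on the
  face; off it the superincreasing tie-break separates them. The optimum also solves the relaxation,
  because relaxed solutions within the threshold are nonnegative and so feasible for the integer
  program.\<close>

lemma ip_optimal_unique_and_group:
  assumes rank: "full_row_rank d n A"
    and max: "maximal_face \<Delta> \<sigma>"
    and cone: "(\<lambda>i. real_of_int (b i)) \<in> cone_of d A \<sigma>"
  shows "(\<exists>!x. ip_optimal d n A (\<lambda>j. real_of_int (c j)) b x)
    \<and> group_solves d n A (\<lambda>j. real_of_int (c j)) \<sigma> b"
proof -
  have \<sigma>: "\<sigma> \<in> \<Delta>" using max by (simp add: maximal_face_def)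
  from max cone obtain x0 :: "nat \<Rightarrow> int" and \<beta> :: "nat \<Rightarrow> int" and C :: real where
    x0: "group_feasible d n A \<sigma> b x0" "\<And>j. x0 j \<ge> 0" and \<beta>: "\<And>j. \<beta> j \<ge> 0"
    and face: "\<And>x j. group_feasible d n A \<sigma> b x \<Longrightarrow> rcost \<sigma> x \<le> rcost \<sigma> x0 \<Longrightarrow> j \<in> \<sigma> \<Longrightarrow> x j = \<beta> j"
    and bound: "\<And>x j. group_feasible d n A \<sigma> b x \<Longrightarrow> rcost \<sigma> x \<le> rcost \<sigma> x0
      \<Longrightarrow> j \<in> {..<n} - \<sigma> \<Longrightarrow> real_of_int (x j) \<le> B"
    and tie: "\<And>x. group_feasible d n A \<sigma> b x \<Longrightarrow> rcost \<sigma> x \<le> rcost \<sigma> x0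
      \<Longrightarrow> rcost \<sigma> x = C + (\<Sum>j\<in>{..<n} - \<sigma>. f j * real_of_int (x j))"
    by (rule cheap_group_solutions) blast
  note x0_ip = ip_feasible_of_group[OF x0]
  let ?opt = "ip_optimal d n A (\<lambda>j. real_of_int (c j)) b"
  obtain z where z: "?opt z" using ip_optimal_exists[OF \<sigma> x0_ip] by blast
  have cheap: "rcost \<sigma> (\<lambda>j. int (x j)) \<le> rcost \<sigma> x0" if "?opt x" for x
    using that x0_ip x0(2) unfolding ip_optimal_iff[OF \<sigma>] by fastforce
  have unique: "x = z" if x: "?opt x" for x
  proof
    have xf: "ip_feasible d n A b x" "ip_feasible d n A b z"
      using x z by (simp_all add: ip_optimal_def)
    note xg = xf[THEN group_feasible_of_ip[where \<sigma> = \<sigma>]]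
    \<comment> \<open>Zero on the face, so that the tie-break sum extends to all indices below
      \<open>n\<close>, as \<open>superincreasing_zero\<close> expects.\<close>
    define e where "e j = (if j \<in> \<sigma> then 0 else int (x j) - int (z j))" for j
    have "rcost \<sigma> (\<lambda>j. int (x j)) = rcost \<sigma> (\<lambda>j. int (z j))"
      using x z unfolding ip_optimal_iff[OF \<sigma>] by (meson order_antisym)
    then have "(\<Sum>j\<in>{..<n} - \<sigma>. f j * real (x j)) = (\<Sum>j\<in>{..<n} - \<sigma>. f j * real (z j))"
      using tie[OF xg(1) cheap[OF x]] tie[OF xg(2) cheap[OF z]] by simp
    then have "(\<Sum>j\<in>{..<n} - \<sigma>. f j * real_of_int (e j)) = 0"
      by (simp add: e_def sum_subtractf algebra_simps)
    then have sum0: "(\<Sum>j<n. f j * real_of_int (e j)) = 0"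
      unfolding sum_split_face[OF \<sigma>] by (simp add: e_def)
    \<comment> \<open>Off the face both entries lie between 0 and \<open>B\<close>.\<close>
    have "real_of_int \<bar>e j\<bar> \<le> B" if "j < n" for j
      using bound[OF xg(1) cheap[OF x], of j] bound[OF xg(2) cheap[OF z], of j] that B_nonneg
      by (auto simp: e_def)
    then have e0: "\<forall>j<n. e j = 0"
      using superincreasing_zero[OF f_super f_pos B_nonneg _ sum0] by blast
    fix j
    show "x j = z j"
    proof (cases "j < n")
      case True
      show ?thesis
      proof (cases "j \<in> \<sigma>")
        case True
        have "int (x j) = int (z j)"
          using face[OF xg(1) cheap[OF x] True] face[OF xg(2) cheap[OF z] True] by simp
        then show ?thesis by simp
      next
        case False
        then have "int (x j) - int (z j) = 0"
          using e0 \<open>j < n\<close> unfolding e_def by metis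
        then show ?thesis by simp
      qed
    next
      case False
      then show ?thesis using xf by (simp add: ip_feasible_def)
    qed
  qed
  have objective: "group_objective d n A (\<lambda>j. real_of_int (c j)) \<sigma> x = rcost \<sigma> x" for x
    by (simp add: group_objective_def rcost_def reduced_cost_eq[OF rank max])
  have "group_optimal d n A (\<lambda>j. real_of_int (c j)) \<sigma> b (\<lambda>j. int (z j))"
    unfolding group_optimal_def objective
  proof (intro conjI allI impI)
    show "group_feasible d n A \<sigma> b (\<lambda>j. int (z j))"
      using z by (intro group_feasible_of_ip) (simp add: ip_optimal_def)
    fix x assume x: "group_feasible d n A \<sigma> b x"
    show "rcost \<sigma> (\<lambda>j. int (z j)) \<le> rcost \<sigma> x"
    proof (cases "rcost \<sigma> x \<le> rcost \<sigma> x0")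
      case True
      have nonneg: "x j \<ge> 0" for j
        using x face[OF x True, of j] \<beta>[of j] unfolding group_feasible_def
        by (cases "j \<in> \<sigma>"; cases "j < n") auto
      show ?thesis
        using z ip_feasible_of_group[OF x nonneg] nonneg
        unfolding ip_optimal_iff[OF \<sigma>] by fastforce
    next
      case False
      then show ?thesis using cheap[OF z] by linarith
    qed
  qed
  then have "group_solves d n A (\<lambda>j. real_of_int (c j)) \<sigma> b"
    unfolding group_solves_def by (intro exI[of _ "\<lambda>j. int (z j)"]) simp
  then show ?thesis using z unique by blast
qed

end

theorem theorem4p7:
  fixes d n :: nat and A :: "nat \<Rightarrow> nat \<Rightarrow> int" and \<Delta> :: "nat set set"
  assumes "standing_assms d n A"
    and "regular_triangulation d n A \<Delta>"
    and "Delta_normal d n A \<Delta>"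
  shows "\<exists>c :: nat \<Rightarrow> int.
           generic_cost d n A (\<lambda>j. real_of_int (c j)) \<and>
           \<Delta> = Delta d n A (\<lambda>j. real_of_int (c j)) \<and>
           gomory_family d n A (\<lambda>j. real_of_int (c j))"
proof -
  have rank: "full_row_rank d n A" and kernel: "trivial_pos_kernel d n A"
    using assms(1) by (simp_all add: standing_assms_def)
  obtain w where tri: "is_triangulation d n A \<Delta>" and w: "\<Delta> = Delta d n A w"
    using assms(2) by (auto simp: regular_triangulation_def)
  have "\<forall>\<sigma>\<in>\<Delta>. \<exists>y. (\<forall>j\<in>\<sigma>. dotc d A y j = w j) \<and> (\<forall>j\<in>{..<n} - \<sigma>. dotc d A y j < w j)"
    unfolding w Delta_def by blast
  then obtain Y where Y: "\<forall>\<sigma>\<in>\<Delta>. (\<forall>j\<in>\<sigma>. dotc d A (Y \<sigma>) j = w j) \<and>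
      (\<forall>j\<in>{..<n} - \<sigma>. dotc d A (Y \<sigma>) j < w j)"
    by metis
  \<comment> \<open>A zero column would put a unit vector into the nonnegative kernel.\<close>
  have nonzero: "\<exists>i<d. A i j \<noteq> 0" if "j < n" for j
  proof (rule ccontr)
    assume "\<not> (\<exists>i<d. A i j \<noteq> 0)"
    then have "\<forall>i<d. (\<Sum>k<n. real_of_int (A i k) * (if k = j then 1 else 0)) = 0"
      using that by (simp add: if_distrib cong: if_cong)
    moreover have "\<forall>k<n. (if k = j then 1 else 0 :: real) \<ge> 0" by simp
    ultimately have "\<forall>k<n. (if k = j then 1 else 0 :: real) = 0"
      using kernel[unfolded trivial_pos_kernel_def, THEN spec, of "\<lambda>k. if k = j then 1 else 0"]
      by blast
    then show False using that by auto
  qed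
  interpret T: supported_triangulation d n A \<Delta> w Y
    by unfold_locales (use tri Y nonzero in blast)+
  \<comment> \<open>The sum dominates each quotient, hence gives a common bound for all
    columns.\<close>
  define B where "B = (\<Sum>j<n. real n / T.height j)"
  have B_nonneg: "B \<ge> 0"
    unfolding B_def using T.height_pos by (intro sum_nonneg) (auto simp: less_imp_le)
  have B_height: "real n \<le> B * T.height j" if "j < n" for j
  proof -
    have "real n / T.height j \<le> B"
      unfolding B_def using T.height_pos that by (intro member_le_sum) (auto simp: less_imp_le)
    then show ?thesis using T.height_pos[OF that] by (simp add: pos_divide_le_eq)
  qed
  define K where "K = 2 * B + 1"
  \<comment> \<open>The tie-break \<open>f\<close> exists only after \<open>M\<close> is fixed, so
    its total is bounded in advance through \<open>f j \<le> 2 * K ^ j\<close>.\<close>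
  define F where "F = B * (\<Sum>j<n. 2 * K ^ j)"
  define M where "M = F + 1"
  have K: "K \<ge> 1" using B_nonneg by (simp add: K_def)
  have F: "F \<ge> 0" unfolding F_def using B_nonneg K by (intro mult_nonneg_nonneg sum_nonneg) auto
  have "K \<ge> 0" "M \<ge> 0" "M * real n + F \<ge> 0" using K F by (simp_all add: M_def)
  then obtain c :: "nat \<Rightarrow> int" and f :: "nat \<Rightarrow> real" and Z :: "nat set \<Rightarrow> nat \<Rightarrow> real" where
    f: "\<And>j. K ^ j \<le> f j" "\<And>j. f j \<le> K ^ j + 1"
    and tight: "\<And>\<sigma> j. \<sigma> \<in> \<Delta> \<Longrightarrow> j \<in> \<sigma> \<Longrightarrow> dotc d A (Z \<sigma>) j = real_of_int (c j)"
    and inside: "\<And>\<sigma> j. \<sigma> \<in> \<Delta> \<Longrightarrow> j < n \<Longrightarrow> j \<notin> \<sigma> \<Longrightarrow> colv d A j \<in> cone_of d A \<sigma>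
       \<Longrightarrow> real_of_int (c j) - dotc d A (Z \<sigma>) j = M * T.height j + f j"
    and outside: "\<And>\<sigma> j. \<sigma> \<in> \<Delta> \<Longrightarrow> j < n \<Longrightarrow> colv d A j \<notin> cone_of d A \<sigma>
       \<Longrightarrow> real_of_int (c j) - dotc d A (Z \<sigma>) j > M * real n + F"
    by (rule T.integer_costs) blast
  have Kpow: "K ^ j \<ge> 1" for j using K by (rule one_le_power)
  have f_pos: "f j > 0" for j using f(1)[of j] Kpow[of j] by linarith
  have f_le: "f j \<le> 2 * K ^ j" for j using f(2)[of j] Kpow[of j] by linarith
  have f_super: "f j > B * (\<Sum>i<j. f i)" for j
    using sum_shifted_powers[OF B_nonneg, of f j] f_le f(1)[of j] unfolding K_def by force
  have F_le: "B * (\<Sum>j<n. f j) \<le> F"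
    unfolding F_def using B_nonneg f_le by (intro mult_left_mono sum_mono) auto
  have strict: "dotc d A (Z \<sigma>) j < real_of_int (c j)" if "\<sigma> \<in> \<Delta>" "j < n" "j \<notin> \<sigma>" for \<sigma> j
  proof (cases "colv d A j \<in> cone_of d A \<sigma>")
    case True
    have "M * T.height j \<ge> 0" using \<open>M \<ge> 0\<close> T.height_pos[OF that(2)] by simp
    then show ?thesis using inside[OF that True] f_pos[of j] by linarith
  next
    case False
    then show ?thesis using outside[OF that(1,2) False] \<open>M * real n + F \<ge> 0\<close> by linarith
  qed
  \<comment> \<open>\<open>height\<close> depends on the matrix and the triangulation but on neither
    lift nor support vectors, so facts about \<open>T.height\<close> carry over to the new
    cost.\<close>
  interpret G: gomory_cost d n A \<Delta> c Z M B f
  proof unfold_locales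
    show "real_of_int (c j) - dotc d A (Z \<sigma>) j > M * real n + B * (\<Sum>j<n. f j)"
      if "\<sigma> \<in> \<Delta>" "j < n" "colv d A j \<notin> cone_of d A \<sigma>" for \<sigma> j
      using outside[OF that] F_le by linarith
    show "M > B * (\<Sum>j<n. f j)" using F_le by (simp add: M_def)
  qed (use tri tight strict nonzero assms(3) inside B_nonneg B_height f_pos f_super in blast)+
  have Delta_c: "Delta d n A (\<lambda>j. real_of_int (c j)) = \<Delta>" by (rule G.Delta_eq)
  have solved: "(\<exists>!x. ip_optimal d n A (\<lambda>j. real_of_int (c j)) b x) \<and>
      (\<exists>\<sigma>. maximal_face \<Delta> \<sigma> \<and> group_solves d n A (\<lambda>j. real_of_int (c j)) \<sigma> b)"
    if b: "b \<in> NA d n A" for b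
  proof -
    obtain \<sigma> where "maximal_face \<Delta> \<sigma>" "(\<lambda>i. real_of_int (b i)) \<in> cone_of d A \<sigma>"
      using G.NA_face[OF b] by blast
    then show ?thesis using G.ip_optimal_unique_and_group[OF rank] by blast
  qed
  show ?thesis
    by (rule exI[of _ c], unfold generic_cost_def gomory_family_def Delta_c)
      (use tri solved in blast)
qed

end
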